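(* Let $G$ be a boundary core on $r$ roles with boundaries $U,V$, and let $c_{G,p,\delta}$ denote the number of legal replica states of order $p$ and defect $\delta$. Then for all integers $p\ge2$ and $\delta\ge0$, $$c_{G,p,\delta}\le C_r^{2p}\,p^{a_*p+K_r\delta},\qquad K_r=3r^2+10r+2,$$ where one may take $C_r=200^r(2r)^{2r^2}4^{r^2}$ for $r\ge1$; for $r=0$, one may take $C_0=1$ and $K_0=0$.
   Context: Boundary core: a finite simple graph $G=(W,E)$, $|W|=r$, with ordered tuples $U,V$ of vertices (called roles; each tuple has distinct entries, they may overlap or be empty) such that every connected component of $G$ meets $U\cup V$; in particular there is no isolated vertex outside $U\cup V$. (Isolated boundary vertices are allowed.) Statistics: a separator is a set $S\subseteq W$ meeting every path from $U$ to $V$, including length-zero paths (so $U\cap V\subseteq S$). $s$ is the minimum separator size. $a(S)$ is the number of connected components $K$ of $G-S$ with $K\cap(U\cup V)=\varnothing$ and $K$ adjacent to $S$; $a_*=\max_{|S|=s}a(S)$ over separators. Replica states: index $2p$ replicas by $\{0,\dots,2p-1\}$, with perfect matchings $$\tau=\{\{1,2\},\{3,4\},\dots,\{2p-1,0\}\},\qquad \eta=\{\{0,1\},\{2,3\},\dots,\{2p-2,2p-1\}\}.$$ A set partition of the replicas is even if all its blocks have even size; $\pi\wedge\psi$ is the common refinement; $|\pi|$ is the number of blocks. A legal state assigns to each role $x\in W$ an even partition $\pi_x$ of the replicas such that $\tau$ refines $\pi_x$ for $x\in U$, $\eta$ refines $\pi_x$ for $x\in V$, and $\pi_x\wedge\pi_y$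 is even for every edge $xy\in E$. Its defect $\delta$ is defined by $$\sum_{x\in W}|\pi_x|=p(r-s)+s-\delta.$$ *)

theory Defs
  imports
    "HOL-Library.Disjoint_Sets"
    "HOL-Library.FuncSet"
    "Graph_Theory.Digraph_Component"
    "Graph_Theory.Vertex_Walk"
begin

section \<open>Boundary cores\<close>

text \<open>
  A finite simple graph is a finite symmetric digraph without loops and parallel arcs (locale
  \<^locale>\<open>graph\<close>). Because the arc relation is symmetric, the strongly connected components
  are exactly the connected components of the undirected graph, and the directed vertex paths
  are exactly the undirected paths. The empty graph is allowed.
\<close>

abbreviation components :: "('a, 'b) pre_digraph \<Rightarrow> 'a set set" where
  "components G \<equiv> pre_digraph.sccs_verts G"

definition boundary_core :: "('a, 'b) pre_digraph \<Rightarrow> 'a list \<Rightarrow> 'a list \<Rightarrow> bool" where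
  "boundary_core G U V \<longleftrightarrow>
     graph G \<and> distinct U \<and> distinct V \<and> set U \<subseteq> verts G \<and> set V \<subseteq> verts G \<and>
     (\<forall>K \<in> components G. K \<inter> (set U \<union> set V) \<noteq> {})"

text \<open>
  A path is given by its nonempty list of vertices. The one-element lists are the paths of
  length zero, so every separator contains the common elements of \<open>U\<close> and \<open>V\<close>.
\<close>

definition separator :: "('a, 'b) pre_digraph \<Rightarrow> 'a list \<Rightarrow> 'a list \<Rightarrow> 'a set \<Rightarrow> bool" where
  "separator G U V S \<longleftrightarrow>
     S \<subseteq> verts G \<and>
     (\<forall>P. vpath P G \<and> hd P \<in> set U \<and> last P \<in> set V \<longrightarrow> set P \<inter> S \<noteq> {})"

definition min_sep_size :: "('a, 'b) pre_digraph \<Rightarrow> 'a list \<Rightarrow> 'a list \<Rightarrow> nat" where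
  "min_sep_size G U V = Min (card ` {S. separator G U V S})"

definition free_components ::
    "('a, 'b) pre_digraph \<Rightarrow> 'a list \<Rightarrow> 'a list \<Rightarrow> 'a set \<Rightarrow> 'a set set" where
  "free_components G U V S =
     {K \<in> components (G \<restriction> (verts G - S)).
        K \<inter> (set U \<union> set V) = {} \<and> (\<exists>x \<in> K. \<exists>y \<in> S. x \<rightarrow>\<^bsub>G\<^esub> y)}"

definition max_free :: "('a, 'b) pre_digraph \<Rightarrow> 'a list \<Rightarrow> 'a list \<Rightarrow> nat" where
  "max_free G U V =
     Max ((\<lambda>S. card (free_components G U V S)) `
            {S. separator G U V S \<and> card S = min_sep_size G U V})"


section \<open>Replica states\<close>

definition tau :: "nat \<Rightarrow> nat set set" where
  "tau p = (\<lambda>i. {2 * i + 1, (2 * i + 2) mod (2 * p)}) ` {..<p}"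

definition eta :: "nat \<Rightarrow> nat set set" where
  "eta p = (\<lambda>i. {2 * i, 2 * i + 1}) ` {..<p}"

definition even_partition :: "nat \<Rightarrow> nat set set \<Rightarrow> bool" where
  "even_partition p P \<longleftrightarrow> partition_on {..<2 * p} P \<and> (\<forall>B \<in> P. even (card B))"

text \<open>
  States are extensional functions on the set of roles, so that they can be counted without
  spurious multiplicity from the values outside the graph.
\<close>

definition legal_states ::
    "('a, 'b) pre_digraph \<Rightarrow> 'a list \<Rightarrow> 'a list \<Rightarrow> nat \<Rightarrow> ('a \<Rightarrow> nat set set) set" where
  "legal_states G U V p =
     {\<pi> \<in> verts G \<rightarrow>\<^sub>E {P. even_partition p P}.
        (\<forall>x \<in> set U. refines {..<2 * p} (tau p) (\<pi> x)) \<and>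
        (\<forall>x \<in> set V. refines {..<2 * p} (eta p) (\<pi> x)) \<and>
        (\<forall>x y. x \<rightarrow>\<^bsub>G\<^esub> y \<longrightarrow> even_partition p (common_refinement {\<pi> x, \<pi> y}))}"

definition defect ::
    "('a, 'b) pre_digraph \<Rightarrow> 'a list \<Rightarrow> 'a list \<Rightarrow> nat \<Rightarrow> ('a \<Rightarrow> nat set set) \<Rightarrow> int" where
  "defect G U V p \<pi> =
     int p * (int (card (verts G)) - int (min_sep_size G U V)) + int (min_sep_size G U V)
       - int (\<Sum>x \<in> verts G. card (\<pi> x))"

definition state_count ::
    "('a, 'b) pre_digraph \<Rightarrow> 'a list \<Rightarrow> 'a list \<Rightarrow> nat \<Rightarrow> nat \<Rightarrow> nat" where
  "state_count G U V p \<delta> = card {\<pi> \<in> legal_states G U V p. defect G U V p \<pi> = int \<delta>}"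

definition C_const :: "nat \<Rightarrow> nat" where
  "C_const r = (if r = 0 then 1 else 200 ^ r * (2 * r) ^ (2 * r\<^sup>2) * 4 ^ (r\<^sup>2))"

definition K_const :: "nat \<Rightarrow> nat" where
  "K_const r = (if r = 0 then 0 else 3 * r\<^sup>2 + 10 * r + 2)"


section \<open>Well-definedness of the extrema and of the count\<close>

lemma separator_verts: "separator G U V (verts G)"
  by (auto simp: separator_def vpath_def vwalk_def Int_absorb2)

lemma finite_separators: "finite (verts G) \<Longrightarrow> finite {S. separator G U V S}"
  by (rule finite_subset[of _ "Pow (verts G)"]) (auto simp: separator_def)

lemma min_sep_size_attained:
  assumes "boundary_core G U V"
  shows "\<exists>S. separator G U V S \<and> card S = min_sep_size G U V"
proof -
  have "finite (verts G)"
    using assms by (auto simp: boundary_core_def graph_def digraph_def fin_digraph_def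
        fin_digraph_axioms_def)
  then have "min_sep_size G U V \<in> card ` {S. separator G U V S}"
    unfolding min_sep_size_def by (intro Min_in) (auto simp: finite_separators intro: separator_verts)
  then show ?thesis by auto
qed

lemma finite_legal_states:
  assumes "boundary_core G U V"
  shows "finite (legal_states G U V p)"
proof -
  have "finite (verts G)"
    using assms by (auto simp: boundary_core_def graph_def digraph_def fin_digraph_def
        fin_digraph_axioms_def)
  moreover have "{P. even_partition p P} \<subseteq> Pow (Pow {..<2 * p})"
    by (auto simp: even_partition_def partition_on_def)
  then have "finite {P. even_partition p P}"
    by (rule finite_subset) simp
  ultimately have "finite (verts G \<rightarrow>\<^sub>E {P. even_partition p P})"
    by (intro finite_PiE)
  then show ?thesis
    by (rule rev_finite_subset) (auto simp: legal_states_def)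
qed

lemma partition_on_eta: "partition_on {..<2 * p} (eta p)"
proof (rule partition_onI)
  show "\<Union> (eta p) = {..<2 * p}"
  proof (intro equalityI subsetI)
    fix k assume "k \<in> {..<2 * p}"
    then have "k div 2 \<in> {..<p}" "k \<in> {2 * (k div 2), 2 * (k div 2) + 1}" by auto
    then show "k \<in> \<Union> (eta p)" unfolding eta_def by blast
  qed (auto simp: eta_def)
next
  fix A B assume "A \<in> eta p" "B \<in> eta p" "A \<noteq> B"
  then show "disjnt A B" by (auto simp: eta_def disjnt_def; presburger)
qed (auto simp: eta_def)

lemma partition_on_tau: "partition_on {..<2 * p} (tau p)"
proof (rule partition_onI)
  show "\<Union> (tau p) = {..<2 * p}"
  proof (intro equalityI subsetI)
    fix k assume "k \<in> \<Union> (tau p)"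
    then show "k \<in> {..<2 * p}" by (auto simp: tau_def)
  next
    fix k assume k: "k \<in> {..<2 * p}"
    define i where "i = (if odd k then k div 2 else if k = 0 then p - 1 else k div 2 - 1)"
    have "i < p" using k by (auto simp: i_def)
    moreover have "k = 2 * i + 1 \<or> k = (2 * i + 2) mod (2 * p)"
    proof (cases "k = 0")
      case True
      then have "2 * i + 2 = 2 * p" using k by (auto simp: i_def)
      then show ?thesis using True by simp
    next
      case False
      show ?thesis
      proof (cases "odd k")
        case False
        then have "2 * i + 2 = k" using \<open>k \<noteq> 0\<close> by (auto simp: i_def elim!: evenE)
        then show ?thesis using k by simp
      qed (simp add: i_def)
    qed
    ultimately show "k \<in> \<Union> (tau p)" unfolding tau_def by blast
  qed
next
  have succ: "(2 * i + 2) mod (2 * p) = (if i = p - 1 then 0 else 2 * i + 2)" if "i < p" for i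
  proof (cases "i = p - 1")
    case True
    then have "2 * i + 2 = 2 * p" using that by linarith
    then show ?thesis using True by simp
  qed (use that in simp)
  fix A B assume "A \<in> tau p" "B \<in> tau p" "A \<noteq> B"
  then obtain i j where "i < p" "j < p" "i \<noteq> j"
    "A = {2 * i + 1, if i = p - 1 then 0 else 2 * i + 2}"
    "B = {2 * j + 1, if j = p - 1 then 0 else 2 * j + 2}"
    unfolding tau_def using succ by auto
  then show "disjnt A B" by (auto simp: disjnt_def split: if_splits; presburger)
qed (auto simp: tau_def)

end

theory Submission
  imports Defs
begin

text \<open>
  For a role \<open>x\<close>, call a replica \<open>n\<close> first or last if it is the least or the greatest element of its
  block in \<open>\<pi>\<^sub>x\<close>, and call \<open>x\<close> middle at \<open>n\<close> otherwise. Except for the two extreme replicas, a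
  boundary role is matched to \<open>n - 1\<close> on one side and to \<open>n + 1\<close> on the other, while by parity no edge
  joins a last role to a first one. So the middle roles form a separator at every interior replica. Each
  block has one first and one last replica, so \<open>2 |\<pi>\<^sub>x|\<close> counts the replicas where \<open>x\<close> is not middle,
  and all but at most \<open>2 \<delta>\<close> interior replicas have a minimum separator as their set of middle roles.

  Given which replicas are first and last, a state is decoded from left to right. If \<open>y\<close> is last at
  \<open>n\<close> and its block is known, then parity determines the block of every neighbour of \<open>y\<close>. Starting from
  the boundary roles matched to \<open>n - 1\<close>, this determines at a minimum separator all middle roles and all
  last roles, except for the free components all of whose roles are last: each of these costs one of at
  most \<open>p\<close> blocks. Reversing the order of the replicas exchanges first and last, so in one of the two
  directions there are at most \<open>p a\<^sub>*\<close> such choices in total.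
\<close>

section \<open>Walks, separators and free components\<close>

lemma vwalk_Cons_iff:
  "p \<noteq> [] \<Longrightarrow> vwalk (a # p) G \<longleftrightarrow> a \<in> verts G \<and> a \<rightarrow>\<^bsub>G\<^esub> hd p \<and> vwalk p G"
  by (simp add: vwalk_def) blast

text \<open>Propagation is demanded only from vertices strictly before \<open>x\<close>. In the
  application these avoid the separator, while \<open>x\<close> itself may lie in it.\<close>

lemma vwalk_prefix_propagate:
  assumes "vwalk (A @ x # B) G" and "Q (hd (A @ x # B))"
    and "\<And>y z. y \<in> set A \<Longrightarrow> Q y \<Longrightarrow> y \<rightarrow>\<^bsub>G\<^esub> z \<Longrightarrow> Q z"
  shows "Q x"
  using assms
proof (induction A)
  case (Cons a A)
  have "a \<rightarrow>\<^bsub>G\<^esub> hd (A @ x # B)" "vwalk (A @ x # B) G"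
    using Cons.prems(1) vwalk_Cons_iff[of "A @ x # B" a G] by (simp_all only: append_Cons) blast+
  show ?case
  proof (rule Cons.IH)
    show "Q (hd (A @ x # B))"
      by (rule Cons.prems(3)[of a]) (use Cons.prems(2) \<open>a \<rightarrow>\<^bsub>G\<^esub> hd (A @ x # B)\<close> in simp_all)
    show "Q z" if "y \<in> set A" "Q y" "y \<rightarrow>\<^bsub>G\<^esub> z" for y z
      by (rule Cons.prems(3)[of y z]) (use that in simp_all)
  qed fact
qed simp

lemma vwalk_suffix_propagate:
  assumes "vwalk (A @ x # B) G" and "Q (last (A @ x # B))"
    and "\<And>y z. y \<in> set B \<Longrightarrow> Q y \<Longrightarrow> z \<rightarrow>\<^bsub>G\<^esub> y \<Longrightarrow> Q z"
  shows "Q x"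
proof -
  have "vwalk (x # B) G" using assms(1) by (rule vwalkI_append_r[rotated]) simp
  moreover have "Q (last (x # B))" using assms(2) by simp
  ultimately show ?thesis using assms(3)
  proof (induction B arbitrary: x)
    case (Cons b B)
    have "x \<rightarrow>\<^bsub>G\<^esub> b" "vwalk (b # B) G"
      using Cons.prems(1) vwalk_Cons_iff[of "b # B" x G] by simp_all
    have "Q b"
    proof (rule Cons.IH)
      show "Q (last (b # B))" using Cons.prems(2) by simp
      show "Q z" if "y \<in> set B" "Q y" "z \<rightarrow>\<^bsub>G\<^esub> y" for y z
        by (rule Cons.prems(3)[of y z]) (use that in simp_all)
    qed fact
    then show ?case by (rule Cons.prems(3)[of b x, rotated]) (simp_all add: \<open>x \<rightarrow>\<^bsub>G\<^esub> b\<close>)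
  qed simp
qed

section \<open>Minimum separators\<close>

lemma min_sep_size_le:
  assumes "finite (verts G)" and "separator G U V S"
  shows "min_sep_size G U V \<le> card S"
  unfolding min_sep_size_def using assms by (intro Min_le) (auto simp: finite_separators)

text \<open>By minimality \<open>S - {x}\<close> fails to separate, so some path avoids it. That
  path still meets \<open>S\<close>, hence in \<open>x\<close> alone, and since its vertices are
  distinct both remaining pieces avoid \<open>S\<close> entirely.\<close>

lemma min_separator_path:
  assumes "finite (verts G)" and "separator G U V S" and "card S = min_sep_size G U V"
    and "x \<in> S"
  obtains A B where "vwalk (A @ x # B) G" "hd (A @ x # B) \<in> set U" "last (A @ x # B) \<in> set V"
    "set A \<inter> S = {}" "set B \<inter> S = {}"
proof -
  have "finite S" using assms(1,2) by (auto simp: separator_def intro: finite_subset)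
  then have "card (S - {x}) < card S" using \<open>x \<in> S\<close> by (rule card_Diff1_less)
  then have "\<not> separator G U V (S - {x})"
    using min_sep_size_le[OF assms(1), of U V "S - {x}"] assms(3) by auto
  then obtain P where P: "vpath P G" "hd P \<in> set U" "last P \<in> set V" "set P \<inter> (S - {x}) = {}"
    using assms(2) unfolding separator_def by blast
  moreover have "set P \<inter> S \<noteq> {}" using assms(2) P unfolding separator_def by blast
  ultimately have "x \<in> set P" by blast
  then obtain A B where AB: "P = A @ x # B" by (meson split_list)
  moreover have "distinct P" "vwalk P G" using P(1) by auto
  ultimately show ?thesis using P by (intro that[of A B]) auto
qed

section \<open>Components of induced subgraphs\<close>

lemma in_components_conv:
  "K \<in> components G \<longleftrightarrow> K \<noteq> {} \<and> (\<forall>u \<in> K. \<forall>v \<in> K. u \<rightarrow>\<^sup>*\<^bsub>G\<^esub> v) \<and>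
     (\<forall>u \<in> K. \<forall>v. v \<notin> K \<longrightarrow> \<not> u \<rightarrow>\<^sup>*\<^bsub>G\<^esub> v \<or> \<not> v \<rightarrow>\<^sup>*\<^bsub>G\<^esub> u)"
  by (simp add: pre_digraph.sccs_verts_def)

lemma adj_induce_subgraph:
  "u \<rightarrow>\<^bsub>G \<restriction> S\<^esub> v \<longleftrightarrow> u \<rightarrow>\<^bsub>G\<^esub> v \<and> u \<in> S \<and> v \<in> S"
  by (auto simp: arcs_ends_def arc_to_ends_def)

context graph
begin

lemma adj_commute: "x \<rightarrow>\<^bsub>G\<^esub> y \<longleftrightarrow> y \<rightarrow>\<^bsub>G\<^esub> x"
  using arcs_ends_symmetric[OF sym_arcs] by blast

lemma component_subset:
  assumes "K \<in> components (G \<restriction> S)"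
  shows "K \<subseteq> S"
  using wf_digraph.sccs_verts_subsets[OF wellformed_induce_subgraph assms] by simp

lemma component_of:
  assumes "x \<in> S" "S \<subseteq> verts G"
  obtains K where "K \<in> components (G \<restriction> S)" "x \<in> K"
proof -
  interpret GS: wf_digraph "G \<restriction> S" by (rule wellformed_induce_subgraph)
  have x: "x \<in> verts (G \<restriction> S)" using assms by simp
  show ?thesis
    using that[OF GS.scc_of_in_sccs_verts[OF x] GS.in_scc_of_self[OF x]] .
qed

text \<open>
  A component of \<open>G - S\<close> that meets neither boundary and is not adjacent to \<open>S\<close> would be a
  component of \<open>G\<close>, which is impossible in a boundary core.
\<close>

lemma free_component_adjacent:
  assumes core: "boundary_core G U V" and S: "S \<subseteq> verts G"
    and K: "K \<in> components (G \<restriction> (verts G - S))" "K \<inter> (set U \<union> set V) = {}"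
  shows "K \<in> free_components G U V S"
proof (rule ccontr)
  assume "K \<notin> free_components G U V S"
  then have nadj: "\<not> x \<rightarrow>\<^bsub>G\<^esub> y" if "x \<in> K" "y \<in> S" for x y
    using K that by (auto simp: free_components_def)
  let ?H = "G \<restriction> (verts G - S)"
  interpret H: wf_digraph ?H by (rule wellformed_induce_subgraph)
  have KW: "K \<subseteq> verts G - S" using component_subset K(1) by blast
  have closed: "y \<in> K" if "x \<in> K" "x \<rightarrow>\<^bsub>G\<^esub> y" for x y
  proof -
    have "y \<notin> S" using nadj that by blast
    then have "x \<rightarrow>\<^bsub>?H\<^esub> y" "y \<rightarrow>\<^bsub>?H\<^esub> x"
      using that KW adj_in_verts[OF that(2)] adj_commute[of x y]
      by (auto simp: adj_induce_subgraph)
    then have "x \<rightarrow>\<^sup>*\<^bsub>?H\<^esub> y" "y \<rightarrow>\<^sup>*\<^bsub>?H\<^esub> x"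
      by (simp_all add: H.reachable_adjI)
    then show ?thesis using K(1) that(1) by (meson in_components_conv)
  qed
  have reach_in: "v \<in> K" if "u \<rightarrow>\<^sup>*\<^bsub>G\<^esub> v" "u \<in> K" for u v
    using that by (induction rule: reachable_induct) (auto intro: closed)
  have reach: "u \<rightarrow>\<^sup>*\<^bsub>G\<^esub> v" if "u \<in> K" "v \<in> K" for u v
  proof (rule reachable_induce_subgraphD)
    show "u \<rightarrow>\<^sup>*\<^bsub>?H\<^esub> v" using K(1) that by (simp add: in_components_conv)
  qed simp
  have "K \<noteq> {}" using K(1) by (simp add: in_components_conv)
  have "K \<in> components G"
    unfolding in_components_conv
  proof (intro conjI ballI allI impI)
    show "K \<noteq> {}" by fact
    show "u \<rightarrow>\<^sup>*\<^bsub>G\<^esub> v" if "u \<in> K" "v \<in> K" for u v using that by (rule reach)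
    show "\<not> u \<rightarrow>\<^sup>*\<^bsub>G\<^esub> v \<or> \<not> v \<rightarrow>\<^sup>*\<^bsub>G\<^esub> u" if "u \<in> K" "v \<notin> K" for u v
      using reach_in[of u v] that by metis
  qed
  then show False using core K(2) unfolding boundary_core_def by blast
qed

lemma component_propagate:
  assumes "K \<in> components (G \<restriction> S)" and "x \<in> K" "y \<in> K" and "Q x"
    and "\<And>u v. u \<in> S \<Longrightarrow> v \<in> S \<Longrightarrow> u \<rightarrow>\<^bsub>G\<^esub> v \<Longrightarrow> Q u \<Longrightarrow> Q v"
  shows "Q y"
proof -
  interpret GS: wf_digraph "G \<restriction> S" by (rule wellformed_induce_subgraph)
  have "x \<rightarrow>\<^sup>*\<^bsub>G \<restriction> S\<^esub> y" using assms(1-3) by (auto simp: in_components_conv)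
  then show ?thesis
    using assms(4,5) by (induction rule: GS.reachable_induct) (auto simp: adj_induce_subgraph)
qed

lemma card_free_components_le:
  assumes "separator G U V S" and "card S = min_sep_size G U V"
  shows "card (free_components G U V S) \<le> max_free G U V"
proof -
  have "finite {S. separator G U V S \<and> card S = min_sep_size G U V}"
    using finite_separators[OF finite_verts, of U V] by (rule rev_finite_subset) auto
  then show ?thesis
    unfolding max_free_def using assms by (intro Max_ge) auto
qed

lemma finite_free_components: "finite (free_components G U V S)"
proof (rule finite_subset)
  show "free_components G U V S \<subseteq> Pow (verts G)"
    by (auto simp: free_components_def dest!: component_subset)
qed simp

end

section \<open>Families of replica relations\<close>

text \<open>The conjunct \<open>R x n n\<close> excludes pairs outside the domain of
  \<open>R\<close>, where the minimality clause would hold vacuously.\<close>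

definition firsts :: "('a \<Rightarrow> nat \<Rightarrow> nat \<Rightarrow> bool) \<Rightarrow> ('a \<times> nat) set" where
  "firsts R = {(x, n). R x n n \<and> (\<forall>j. R x n j \<longrightarrow> n \<le> j)}"

definition lasts :: "('a \<Rightarrow> nat \<Rightarrow> nat \<Rightarrow> bool) \<Rightarrow> ('a \<times> nat) set" where
  "lasts R = {(x, n). R x n n \<and> (\<forall>j. R x n j \<longrightarrow> j \<le> n)}"

definition middle :: "('a, 'b) pre_digraph \<Rightarrow> ('a \<times> nat) set \<Rightarrow> ('a \<times> nat) set \<Rightarrow> nat \<Rightarrow> 'a set" where
  "middle G F L n = {x \<in> verts G. (x, n) \<notin> F \<and> (x, n) \<notin> L}"

lemma middle_commute: "middle G L F n = middle G F L n"
  by (auto simp: middle_def)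

text \<open>The least element serves as the name of the block of \<open>n\<close>; it is itself a
  first replica.\<close>

definition lead :: "('a \<Rightarrow> nat \<Rightarrow> nat \<Rightarrow> bool) \<Rightarrow> 'a \<times> nat \<Rightarrow> nat" where
  "lead R = (\<lambda>(x, n). LEAST j. R x n j)"

text \<open>
  The condition \<open>boundary\<close> keeps only the pairs of \<open>tau\<close> and \<open>eta\<close> of the form \<open>{n, n + 1}\<close>;
  the pair \<open>{2 * p - 1, 0}\<close> of \<open>tau\<close> is never needed.
\<close>

locale replica_family = graph G
  for G :: "('a, 'b) pre_digraph" +
  fixes U V :: "'a list" and p :: nat and R :: "'a \<Rightarrow> nat \<Rightarrow> nat \<Rightarrow> bool"
  assumes core: "boundary_core G U V"
    and rel_dom: "R x i j \<Longrightarrow> x \<in> verts G \<and> i < 2 * p \<and> j < 2 * p"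
    and rel_refl: "x \<in> verts G \<Longrightarrow> i < 2 * p \<Longrightarrow> R x i i"
    and rel_sym: "R x i j \<Longrightarrow> R x j i"
    and rel_trans: "R x i j \<Longrightarrow> R x j k \<Longrightarrow> R x i k"
    and nontrivial: "x \<in> verts G \<Longrightarrow> i < 2 * p \<Longrightarrow> \<exists>j. j \<noteq> i \<and> R x i j"
    and parity: "x \<rightarrow>\<^bsub>G\<^esub> y \<Longrightarrow> even (card {j. R x i j \<and> R y k j})"
    and boundary: "Suc n < 2 * p \<Longrightarrow> x \<in> set (if even n then V else U) \<Longrightarrow> R x n (Suc n)"
begin

section \<open>First, last and middle roles at a replica\<close>

lemma rel_iff: "R x i j \<Longrightarrow> R x i k \<longleftrightarrow> R x j k"
  using rel_sym rel_trans by blast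

lemma firsts_subset: "firsts R \<subseteq> verts G \<times> {..<2 * p}"
  using rel_dom by (auto simp: firsts_def)

lemma lasts_subset: "lasts R \<subseteq> verts G \<times> {..<2 * p}"
  using rel_dom by (auto simp: lasts_def)

text \<open>A replica that is both first and last would form a singleton block, against
  \<open>nontrivial\<close>.\<close>

lemma firsts_lasts_disjoint: "firsts R \<inter> lasts R = {}"
proof -
  have False if "(x, n) \<in> firsts R" "(x, n) \<in> lasts R" for x n
  proof -
    have "R x n n" using that by (auto simp: firsts_def)
    then obtain j where "j \<noteq> n" "R x n j" using nontrivial rel_dom by blast
    then show False using that by (force simp: firsts_def lasts_def)
  qed
  then show ?thesis by auto
qed

text \<open>An edge whose ends were at a first and at a last replica would meet only that replica.\<close>

lemma no_last_first_edge:
  assumes "x \<rightarrow>\<^bsub>G\<^esub> y" "(x, n) \<in> lasts R" "(y, n) \<in> firsts R"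
  shows False
proof -
  have "j = n" if "R x n j" "R y n j" for j
    using assms(2,3) that by (force simp: firsts_def lasts_def)
  then have "{j. R x n j \<and> R y n j} = {n}"
    using assms(2,3) by (auto simp: firsts_def lasts_def)
  then show False using parity[OF assms(1), of n n] by simp
qed

text \<open>Outside the middle each end is first or last, and \<open>no_last_first_edge\<close>,
  applied in both directions of the edge, rules out mixed ends. So every component left after
  deleting the middle roles is purely first or purely last.\<close>

lemma last_iff_of_adj:
  assumes "x \<rightarrow>\<^bsub>G\<^esub> y" "x \<notin> middle G (firsts R) (lasts R) n" "y \<notin> middle G (firsts R) (lasts R) n"
  shows "(x, n) \<in> lasts R \<longleftrightarrow> (y, n) \<in> lasts R"
proof -
  have "y \<rightarrow>\<^bsub>G\<^esub> x" "x \<in> verts G" "y \<in> verts G"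
    using assms(1) adj_commute adj_in_verts by blast+
  then have "(x, n) \<in> firsts R \<or> (x, n) \<in> lasts R" "(y, n) \<in> firsts R \<or> (y, n) \<in> lasts R"
    using assms(2,3) by (auto simp: middle_def)
  then show ?thesis
    using no_last_first_edge[OF assms(1), of n] no_last_first_edge[OF \<open>y \<rightarrow>\<^bsub>G\<^esub> x\<close>, of n] by blast
qed

lemma forward_not_last:
  assumes "Suc n < 2 * p" "x \<in> set (if even n then V else U)"
  shows "(x, n) \<notin> lasts R"
  using boundary[OF assms] by (force simp: lasts_def)

text \<open>The pair \<open>{n - 1, n}\<close> has the opposite parity to \<open>{n, n + 1}\<close>,
  so the boundary matched backwards is \<open>U\<close> at even \<open>n\<close> and
  \<open>V\<close> at odd \<open>n\<close>. These roles seed the decoding, since replica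
  \<open>n - 1\<close> is already decoded.\<close>

lemma backward_rel:
  assumes "0 < n" "n < 2 * p" "x \<in> set (if even n then U else V)"
  shows "R x n (n - 1)"
proof -
  have "x \<in> set (if even (n - 1) then V else U)" using assms by auto
  then show ?thesis using boundary[of "n - 1" x] assms by (auto intro: rel_sym)
qed

lemma backward_not_first:
  assumes "0 < n" "n < 2 * p" "x \<in> set (if even n then U else V)"
  shows "(x, n) \<notin> firsts R"
  using backward_rel[OF assms] assms(1) by (force simp: firsts_def)

lemma backward_last:
  assumes "0 < n" "n < 2 * p" "x \<in> set (if even n then U else V)"
    and "x \<notin> middle G (firsts R) (lasts R) n"
  shows "(x, n) \<in> lasts R"
  using backward_not_first[OF assms(1-3)] rel_dom[OF backward_rel[OF assms(1-3)]] assms(4)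
  by (auto simp: middle_def)

text \<open>Along a path avoiding the middle, being last is constant by
  \<open>last_iff_of_adj\<close>. But at an interior replica one end is matched backwards, hence
  last, and the other is matched forwards, hence not last; the parity of \<open>n\<close> decides
  which is which.\<close>

lemma separator_middle:
  assumes "0 < n" "Suc n < 2 * p"
  shows "separator G U V (middle G (firsts R) (lasts R) n)"
  unfolding separator_def
proof (intro conjI allI impI)
  let ?S = "middle G (firsts R) (lasts R) n"
  show "?S \<subseteq> verts G" by (auto simp: middle_def)
  fix P assume P: "vpath P G \<and> hd P \<in> set U \<and> last P \<in> set V"
  show "set P \<inter> ?S \<noteq> {}"
  proof
    assume avoid: "set P \<inter> ?S = {}"
    have "vwalk P G" using P by auto
    then have "P \<noteq> []" by auto
    then have ends: "hd P \<notin> ?S" "last P \<notin> ?S"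
      using avoid hd_in_set[of P] last_in_set[of P] by blast+
    have "(hd P, n) \<in> lasts R \<longleftrightarrow> (last P, n) \<in> lasts R"
      using \<open>vwalk P G\<close> avoid
    proof (induction P rule: vwalk_induct)
      case (Cons u v es)
      then have "(u, n) \<in> lasts R \<longleftrightarrow> (v, n) \<in> lasts R" by (intro last_iff_of_adj) auto
      then show ?case using Cons by auto
    qed simp
    then show False
      using P ends assms backward_last[of n "hd P"] backward_last[of n "last P"]
        forward_not_last[of n "hd P"] forward_not_last[of n "last P"]
      by (cases "even n") auto
  qed
qed

text \<open>
  The step that makes the decoding deterministic. Since the block of \<open>y\<close> closes at \<open>n\<close>, it has met
  every other block of \<open>x\<close> an even number of times before \<open>n\<close>; the block of \<open>x\<close> containing \<open>n\<close> is
  the only one that it has met an odd number of times.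
\<close>

lemma rel_iff_odd:
  assumes "y \<rightarrow>\<^bsub>G\<^esub> x" "(y, n) \<in> lasts R" "k < n"
  shows "R x n k \<longleftrightarrow> odd (card {j. j < n \<and> R y n j \<and> R x k j})"
proof -
  let ?A = "{j. j < n \<and> R y n j \<and> R x k j}"
  have "x \<in> verts G" using assms(1) adj_in_verts by blast
  have "R y n n" and le: "\<And>j. R y n j \<Longrightarrow> j \<le> n" using assms(2) by (auto simp: lasts_def)
  then have "n < 2 * p" using rel_dom by blast
  show ?thesis
  proof (cases "R x n k")
    case True
    have "{j. R y n j \<and> R x k j} = insert n ?A"
      using True \<open>R y n n\<close> le rel_sym by (auto simp: order.order_iff_strict)
    moreover have "finite ?A" by (rule finite_subset[of _ "{..<n}"]) auto
    ultimately have "card {j. R y n j \<and> R x k j} = Suc (card ?A)" by simp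
    then show ?thesis using True parity[OF assms(1), of n k] by simp
  next
    case False
    then have "{j. R y n j \<and> R x k j} = ?A"
      using le rel_sym by (auto simp: order.order_iff_strict)
    then show ?thesis using False parity[OF assms(1), of n k] by simp
  qed
qed

lemma
  assumes "x \<in> verts G" "n < 2 * p"
  shows rel_lead: "R x n (lead R (x, n))"
    and lead_le: "lead R (x, n) \<le> n"
    and lead_first: "(x, lead R (x, n)) \<in> firsts R"
proof -
  have "R x n n" using assms by (rule rel_refl)
  show rel: "R x n (lead R (x, n))" unfolding lead_def prod.case using \<open>R x n n\<close> by (rule LeastI)
  have least: "lead R (x, n) \<le> j" if "R x n j" for j
    unfolding lead_def prod.case using that by (rule Least_le)
  then show "lead R (x, n) \<le> n" using \<open>R x n n\<close> by blast
  have "R x n j" if "R x (lead R (x, n)) j" for j using rel that by (rule rel_trans)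
  then show "(x, lead R (x, n)) \<in> firsts R"
    using least rel_dom[OF rel] rel_refl by (auto simp: firsts_def)
qed

end

section \<open>Decoding\<close>

text \<open>Here \<open>F\<close> and \<open>L\<close> stand for \<open>firsts R\<close> and \<open>lasts R\<close>; they are exchanged when the order is reversed.\<close>

definition closing_components ::
    "('a, 'b) pre_digraph \<Rightarrow> 'a list \<Rightarrow> 'a list \<Rightarrow> ('a \<times> nat) set \<Rightarrow> ('a \<times> nat) set \<Rightarrow> nat \<Rightarrow> 'a set set" where
  "closing_components G U V F L n =
     {K \<in> free_components G U V (middle G F L n). K \<times> {n} \<subseteq> L}"

text \<open>The two inequalities make \<open>n\<close> interior, which is what
  \<open>separator_middle\<close> requires.\<close>

definition regular ::
    "('a, 'b) pre_digraph \<Rightarrow> 'a list \<Rightarrow> 'a list \<Rightarrow> nat \<Rightarrow> ('a \<times> nat) set \<Rightarrow> ('a \<times> nat) set \<Rightarrow> nat \<Rightarrow> bool" where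
  "regular G U V p F L n \<longleftrightarrow>
     0 < n \<and> Suc n < 2 * p \<and> card (middle G F L n) = min_sep_size G U V"

text \<open>The places where the decoder must be told the block: all roles at an irregular replica,
  but only one representative of each closing component at a regular one. The set depends on
  \<open>F\<close> and \<open>L\<close> alone, so it can be read off before the leads are
  known.\<close>

definition hints ::
    "('a, 'b) pre_digraph \<Rightarrow> 'a list \<Rightarrow> 'a list \<Rightarrow> nat \<Rightarrow> ('a \<times> nat) set \<Rightarrow> ('a \<times> nat) set \<Rightarrow> ('a \<times> nat) set" where
  "hints G U V p F L =
     {(x, n). x \<in> verts G \<and> n < 2 * p \<and>
        (regular G U V p F L n \<longrightarrow> x \<in> (\<lambda>K. SOME y. y \<in> K) ` closing_components G U V F L n)}"

text \<open>Row \<open>n\<close> of a role is known if the role is first at \<open>n\<close>, shares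
  an earlier partner in both families, carries a hint, or is adjacent to a known role that is last
  at \<open>n\<close> (by \<open>rel_iff_odd\<close>). At a regular replica these rules reach every
  role.\<close>

lemma (in replica_family) decode_step:
  assumes R': "replica_family G U V p R'"
    and F: "firsts R' = firsts R" and L: "lasts R' = lasts R"
    and hint: "\<And>h. h \<in> hints G U V p (firsts R) (lasts R) \<Longrightarrow> lead R' h = lead R h"
    and n: "n < 2 * p"
    and below: "\<And>x i j. i < n \<Longrightarrow> j < n \<Longrightarrow> R' x i j \<longleftrightarrow> R x i j"
    and x: "x \<in> verts G" and k: "k < n"
  shows "R' x n k \<longleftrightarrow> R x n k"
proof -
  interpret R': replica_family G U V p R' by (rule R')
  define known where "known z \<longleftrightarrow> (\<forall>k<n. R' z n k \<longleftrightarrow> R z n k)" for z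
  \<comment> \<open>Replacing \<open>n\<close> by its partner \<open>m\<close> in both families
    moves the question to replicas below \<open>n\<close>.\<close>
  have rel_known: "known z" if "m < n" "R z n m" "R' z n m" for z m
    unfolding known_def
    using rel_iff[OF that(2)] R'.rel_iff[OF that(3)] below[OF that(1)] by blast
  have first_known: "known z" if "(z, n) \<in> firsts R" for z
  proof -
    have "(z, n) \<in> firsts R'" using that F by simp
    then have "\<not> R z n k \<and> \<not> R' z n k" if "k < n" for k
      using \<open>(z, n) \<in> firsts R\<close> that leD by (auto simp: firsts_def)
    then show ?thesis by (simp add: known_def)
  qed
  have hint_known: "known z" if "(z, n) \<in> hints G U V p (firsts R) (lasts R)" for z
  proof -
    have z: "z \<in> verts G" using that by (auto simp: hints_def)
    note rel = rel_lead[OF z n] R'.rel_lead[OF z n, unfolded hint[OF that]]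
    show ?thesis
    \<comment> \<open>If the lead is \<open>n\<close> itself, the role is first at \<open>n\<close>;
      otherwise the lead is an earlier partner common to both families.\<close>
    proof (cases "lead R (z, n) = n")
      case True
      then show ?thesis using lead_first[OF z n] first_known by simp
    next
      case False
      then have "lead R (z, n) < n" using lead_le[OF z n] by simp
      then show ?thesis using rel by (rule rel_known)
    qed
  qed
  have backward_known: "known z" if "z \<in> set (if even n then U else V)" "0 < n" for z
    using rel_known[of "n - 1" z] backward_rel[OF \<open>0 < n\<close> n that(1)]
      R'.backward_rel[OF \<open>0 < n\<close> n that(1)] that(2) by simp
  have step_known: "known z" if "y \<rightarrow>\<^bsub>G\<^esub> z" "known y" "(y, n) \<in> lasts R" for y z
    unfolding known_def
  proof (intro allI impI)
    fix k assume "k < n"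
    have "{j. j < n \<and> R' y n j \<and> R' z k j} = {j. j < n \<and> R y n j \<and> R z k j}"
      using \<open>known y\<close> below \<open>k < n\<close> by (auto simp: known_def)
    then show "R' z n k \<longleftrightarrow> R z n k"
      using rel_iff_odd[OF that(1,3) \<open>k < n\<close>] R'.rel_iff_odd[OF that(1) _ \<open>k < n\<close>] that(3) L by simp
  qed
  show ?thesis
  proof (cases "regular G U V p (firsts R) (lasts R) n")
    case False
    then have "(x, n) \<in> hints G U V p (firsts R) (lasts R)" using x n by (auto simp: hints_def)
    then show ?thesis using hint_known k by (auto simp: known_def)
  next
    case True
    let ?S = "middle G (firsts R) (lasts R) n"
    have n0: "0 < n" "Suc n < 2 * p" and "card ?S = min_sep_size G U V"
      using True by (auto simp: regular_def)
    have S: "separator G U V ?S" using n0 by (rule separator_middle)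
    \<comment> \<open>The invariant carried along edges: known, and last unless in the separator.
      Leaving a vertex outside \<open>?S\<close> is possible because that vertex is last.\<close>
    have outside: "known z \<and> (z \<notin> ?S \<longrightarrow> (z, n) \<in> lasts R)"
      if "y \<rightarrow>\<^bsub>G\<^esub> z" "y \<notin> ?S" "known y \<and> (y \<notin> ?S \<longrightarrow> (y, n) \<in> lasts R)" for y z
      using that step_known[of y z] last_iff_of_adj[of y z n] by blast
    have "known x"
    proof (cases "x \<in> ?S")
      case True
      \<comment> \<open>The path is followed to \<open>x\<close> from its backward-matched end: from
        \<open>U\<close> if \<open>n\<close> is even, from \<open>V\<close> if \<open>n\<close> is
        odd.\<close>
      then obtain A B where AB: "vwalk (A @ x # B) G" "hd (A @ x # B) \<in> set U"
        "last (A @ x # B) \<in> set V" "set A \<inter> ?S = {}" "set B \<inter> ?S = {}"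
        using min_separator_path[OF finite_verts S \<open>card ?S = _\<close>] by blast
      have base: "known y \<and> (y \<notin> ?S \<longrightarrow> (y, n) \<in> lasts R)"
        if "y \<in> set (if even n then U else V)" for y
        using backward_known[OF that n0(1)] backward_last[OF n0(1) n that] by blast
      show ?thesis
      proof (cases "even n")
        case True
        then have "known (hd (A @ x # B)) \<and>
            (hd (A @ x # B) \<notin> ?S \<longrightarrow> (hd (A @ x # B), n) \<in> lasts R)"
          using AB(2) base by simp
        then have "known x \<and> (x \<notin> ?S \<longrightarrow> (x, n) \<in> lasts R)"
          by (rule vwalk_prefix_propagate[OF AB(1)]) (use outside AB(4) in blast)
        then show ?thesis ..
      next
        case False
        then have "known (last (A @ x # B)) \<and>
            (last (A @ x # B) \<notin> ?S \<longrightarrow> (last (A @ x # B), n) \<in> lasts R)"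
          using AB(3) base by simp
        then have "known x \<and> (x \<notin> ?S \<longrightarrow> (x, n) \<in> lasts R)"
          by (rule vwalk_suffix_propagate[OF AB(1)]) (use outside AB(5) adj_commute in blast)
        then show ?thesis ..
      qed
    next
      case xS: False
      show ?thesis
      proof (cases "(x, n) \<in> firsts R")
        case True
        then show ?thesis by (rule first_known)
      next
        case False
        then have xl: "(x, n) \<in> lasts R" using xS x by (auto simp: middle_def)
        \<comment> \<open>All of \<open>K\<close> is last together with \<open>x\<close>, so one
          known role anywhere in \<open>K\<close> suffices.\<close>
        obtain K where K: "K \<in> components (G \<restriction> (verts G - ?S))" "x \<in> K"
          using component_of[of x "verts G - ?S"] x xS by blast
        have KS: "K \<subseteq> verts G - ?S" using component_subset K(1) by blast
        have last: "(y, n) \<in> lasts R" if "y \<in> K" for y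
          using K that xl by (rule component_propagate) (use last_iff_of_adj in blast)
        have spread: "known x" if y: "y \<in> K" "known y" for y
        proof -
          have "known x \<and> (x \<notin> ?S \<longrightarrow> (x, n) \<in> lasts R)"
            by (rule component_propagate[OF K(1) y(1) K(2)]) (use y last outside in blast)+
          then show ?thesis ..
        qed
        show ?thesis
        proof (cases "K \<inter> (set U \<union> set V) = {}")
          case True
          then have "K \<in> closing_components G U V (firsts R) (lasts R) n"
            using free_component_adjacent[OF core _ K(1) True] last S
            by (auto simp: closing_components_def separator_def)
          moreover define y where "y = (SOME y. y \<in> K)"
          ultimately have "y \<in> (\<lambda>K. SOME y. y \<in> K) ` closing_components G U V (firsts R) (lasts R) n"
            by blast
          moreover have "y \<in> K" unfolding y_def using K(2) by (rule someI)
          ultimately have "(y, n) \<in> hints G U V p (firsts R) (lasts R)"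
            using KS n by (auto simp: hints_def)
          then show ?thesis using hint_known spread \<open>y \<in> K\<close> by blast
        next
          case False
          then obtain y where y: "y \<in> K" "y \<in> set U \<union> set V" by blast
          \<comment> \<open>A forward-matched role cannot be last, so \<open>y\<close> belongs to
            the backward-matched boundary.\<close>
          then have "y \<in> set (if even n then U else V)"
            using forward_not_last[OF n0(2), of y] last by (auto split: if_splits)
          then show ?thesis using backward_known n0(1) spread y(1) by blast
        qed
      qed
    qed
    then show ?thesis using k by (simp add: known_def)
  qed
qed

text \<open>Induction on \<open>n\<close> shows agreement on the square of replicas below
  \<open>n\<close>: the new row comes from \<open>decode_step\<close>, the new column from symmetry
  and the corner from reflexivity.\<close>

lemma replica_family_eqI:
  assumes R: "replica_family G U V p R" and R': "replica_family G U V p R'"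
    and types: "firsts R' = firsts R" "lasts R' = lasts R"
    and hint: "\<And>h. h \<in> hints G U V p (firsts R) (lasts R) \<Longrightarrow> lead R' h = lead R h"
  shows "R' = R"
proof -
  interpret R: replica_family G U V p R by (rule R)
  interpret R': replica_family G U V p R' by (rule R')
  have "n \<le> 2 * p \<Longrightarrow> i < n \<Longrightarrow> j < n \<Longrightarrow> R' x i j \<longleftrightarrow> R x i j" for n x i j
  proof (induction n arbitrary: x i j)
    case (Suc n)
    show ?case
    proof (cases "x \<in> verts G")
      case True
      have "n < 2 * p" using Suc.prems by simp
      have below: "R' x i j \<longleftrightarrow> R x i j" if "i < n" "j < n" for x i j
        using Suc.IH[of i j x] Suc.prems that by simp
      have new: "R' x n k \<longleftrightarrow> R x n k" if "k < n" for k
        using R' types hint \<open>n < 2 * p\<close> below True that by (rule R.decode_step)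
      have "R' x n n" "R x n n"
        using R.rel_refl R'.rel_refl True \<open>n < 2 * p\<close> by auto
      moreover have "R' x i n \<longleftrightarrow> R' x n i" "R x i n \<longleftrightarrow> R x n i"
        using R.rel_sym R'.rel_sym by blast+
      moreover have "i < n \<or> i = n" "j < n \<or> j = n" using Suc.prems by auto
      ultimately show ?thesis using below[of i j x] new by blast
    qed (use R.rel_dom R'.rel_dom in blast)
  qed simp
  then have "R' x i j \<longleftrightarrow> R x i j" for x i j
    using R.rel_dom[of x i j] R'.rel_dom[of x i j] by blast
  then show ?thesis by blast
qed

section \<open>Counting replica families\<close>

text \<open>A family is coded by its first pairs, its last pairs and the leads at its hints;
  \<open>replica_family_eqI\<close> makes the code injective. Two subsets of a set of size
  \<open>2 * p * card (verts G)\<close> give the power of 16, and each lead is one of at most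
  \<open>p\<close> first replicas of its role.\<close>

lemma (in graph) card_replica_families:
  assumes "0 < p"
    and Q: "\<And>R. R \<in> Q \<Longrightarrow> replica_family G U V p R"
    and firsts_le: "\<And>R x. R \<in> Q \<Longrightarrow> x \<in> verts G \<Longrightarrow> card {n. (x, n) \<in> firsts R} \<le> p"
    and hints_le: "\<And>R. R \<in> Q \<Longrightarrow> card (hints G U V p (firsts R) (lasts R)) \<le> h"
  shows "finite Q \<and> card Q \<le> 16 ^ (p * card (verts G)) * p ^ h"
proof -
  let ?X = "verts G \<times> {..<2 * p}"
  define T where "T = Pow ?X \<times> Pow ?X"
  \<comment> \<open>Types violating the bounds receive the empty set of codes, so
    \<open>p ^ h\<close> bounds every fibre uniformly.\<close>
  define D where "D = (\<lambda>(F, L). if (\<forall>x \<in> verts G. card {n. (x, n) \<in> F} \<le> p) \<and>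
      card (hints G U V p F L) \<le> h
    then PiE (hints G U V p F L) (\<lambda>(x, n). {j. (x, j) \<in> F}) else {})"
  define code where "code R = ((firsts R, lasts R), restrict (lead R) (hints G U V p (firsts R) (lasts R)))"
    for R :: "'a \<Rightarrow> nat \<Rightarrow> nat \<Rightarrow> bool"
  have cardX: "card ?X = 2 * (p * card (verts G))" by (simp add: card_cartesian_product)
  have "card T = 2 ^ card ?X * 2 ^ card ?X"
    by (simp add: T_def card_cartesian_product card_Pow)
  also have "\<dots> = 2 ^ (2 * (p * card (verts G))) * 2 ^ (2 * (p * card (verts G)))"
    by (simp only: cardX)
  also have "\<dots> = (2 ^ 4) ^ (p * card (verts G))"
    unfolding power_mult[symmetric] power_add[symmetric] by simp
  finally have cardT: "card T = 16 ^ (p * card (verts G))" by simp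
  have "finite T" by (simp add: T_def)
  have D: "finite (D t) \<and> card (D t) \<le> p ^ h" if "t \<in> T" for t
  proof -
    obtain F L where t: "t = (F, L)" by (cases t)
    have fin: "finite (hints G U V p F L)"
      by (rule finite_subset[of _ ?X]) (auto simp: hints_def)
    have finj: "finite {j. (x, j) \<in> F}" for x
      by (rule finite_subset[of _ "{..<2 * p}"]) (use that t in \<open>auto simp: T_def\<close>)
    show ?thesis
    proof (cases "(\<forall>x \<in> verts G. card {n. (x, n) \<in> F} \<le> p) \<and> card (hints G U V p F L) \<le> h")
      case True
      then have Dt: "D t = PiE (hints G U V p F L) (\<lambda>(x, n). {j. (x, j) \<in> F})"
        by (simp add: D_def t)
      have "card (D t) = (\<Prod>(x, n) \<in> hints G U V p F L. card {j. (x, j) \<in> F})"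
        unfolding Dt using fin by (simp add: card_PiE case_prod_unfold)
      also have "\<dots> \<le> (\<Prod>(x, n) \<in> hints G U V p F L. p)"
        using True by (intro prod_mono) (auto simp: hints_def)
      also have "\<dots> = p ^ card (hints G U V p F L)" by simp
      also have "\<dots> \<le> p ^ h" using True \<open>0 < p\<close> by (intro power_increasing) auto
      finally show ?thesis unfolding Dt using fin finj by (auto intro!: finite_PiE)
    qed (auto simp: D_def t)
  qed
  have "inj_on code Q"
  proof (rule inj_onI)
    fix R R' assume RQ: "R \<in> Q" "R' \<in> Q" and eq: "code R = code R'"
    from eq have t: "firsts R = firsts R'" "lasts R = lasts R'"
      by (simp_all add: code_def)
    from eq have "restrict (lead R) (hints G U V p (firsts R') (lasts R')) =
        restrict (lead R') (hints G U V p (firsts R') (lasts R'))"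
      by (simp add: code_def t)
    then have "lead R h = lead R' h" if "h \<in> hints G U V p (firsts R') (lasts R')" for h
      using that by (metis restrict_apply')
    then show "R = R'" using Q RQ t by (intro replica_family_eqI) auto
  qed
  moreover have "code ` Q \<subseteq> Sigma T D"
  proof
    fix c assume "c \<in> code ` Q"
    then obtain R where RQ: "R \<in> Q" and c: "c = code R" by blast
    interpret R: replica_family G U V p R using Q[OF RQ] .
    have "(firsts R, lasts R) \<in> T"
      using R.firsts_subset R.lasts_subset by (simp add: T_def)
    moreover have "restrict (lead R) (hints G U V p (firsts R) (lasts R)) \<in> D (firsts R, lasts R)"
      using firsts_le[OF RQ] hints_le[OF RQ] R.lead_first by (auto simp: D_def hints_def)
    ultimately show "c \<in> Sigma T D" by (simp add: c code_def)
  qed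
  moreover have "finite (Sigma T D)" using \<open>finite T\<close> D by blast
  ultimately have "finite Q" "card Q \<le> card (Sigma T D)"
    by (auto intro: inj_on_finite card_inj_on_le)
  have "card (Sigma T D) = (\<Sum>t\<in>T. card (D t))"
    using \<open>finite T\<close> D by (intro card_SigmaI) auto
  also have "\<dots> \<le> (\<Sum>t\<in>T. p ^ h)" using D by (intro sum_mono) auto
  finally show ?thesis
    using \<open>finite Q\<close> \<open>card Q \<le> card (Sigma T D)\<close> cardT by simp
qed

section \<open>Bounding the number of hints\<close>

definition closings ::
    "('a, 'b) pre_digraph \<Rightarrow> 'a list \<Rightarrow> 'a list \<Rightarrow> nat \<Rightarrow> ('a \<times> nat) set \<Rightarrow> ('a \<times> nat) set \<Rightarrow> nat" where
  "closings G U V p F L =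
     (\<Sum>n | regular G U V p F L n. card (closing_components G U V F L n))"

lemma regular_commute: "regular G U V p L F n \<longleftrightarrow> regular G U V p F L n"
  by (simp add: regular_def middle_commute)

lemma finite_regular: "finite {n. regular G U V p F L n}"
  by (rule finite_subset[of _ "{..<2 * p}"]) (auto simp: regular_def)

lemma (in graph) finite_closing_components: "finite (closing_components G U V F L n)"
  unfolding closing_components_def using finite_free_components by (rule rev_finite_subset) auto

lemma (in graph) card_hints_le:
  "card (hints G U V p F L) \<le>
     card (verts G) * card {n. n < 2 * p \<and> \<not> regular G U V p F L n} + closings G U V p F L"
proof -
  let ?I = "{n. n < 2 * p \<and> \<not> regular G U V p F L n}"
  let ?R = "{n. regular G U V p F L n}"
  let ?rep = "\<lambda>K. SOME y. y \<in> K"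
  let ?C = "\<lambda>n. (\<lambda>K. (?rep K, n)) ` closing_components G U V F L n"
  have "hints G U V p F L \<subseteq> verts G \<times> ?I \<union> (\<Union>n\<in>?R. ?C n)"
    by (auto simp: hints_def)
  moreover have "finite (verts G \<times> ?I)" by simp
  moreover have "finite (\<Union>n\<in>?R. ?C n)"
    by (intro finite_UN_I finite_imageI finite_regular finite_closing_components)
  ultimately have "card (hints G U V p F L) \<le> card (verts G \<times> ?I \<union> (\<Union>n\<in>?R. ?C n))"
    by (intro card_mono) auto
  also have "\<dots> \<le> card (verts G \<times> ?I) + card (\<Union>n\<in>?R. ?C n)"
    by (rule card_Un_le)
  also have "card (\<Union>n\<in>?R. ?C n) \<le> (\<Sum>n\<in>?R. card (?C n))"
    using finite_regular by (rule card_UN_le)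
  also have "\<dots> \<le> closings G U V p F L"
    unfolding closings_def by (intro sum_mono card_image_le finite_closing_components)
  finally show ?thesis by (simp add: card_cartesian_product)
qed

text \<open>A free component is nonempty and no role is both first and last at \<open>n\<close>, so
  it closes in at most one of the two directions. Both counts together are therefore at most
  \<open>max_free\<close> at each of at most \<open>2 * p\<close> regular replicas.\<close>

lemma (in replica_family) closings_sum_le:
  "closings G U V p (firsts R) (lasts R) + closings G U V p (lasts R) (firsts R)
     \<le> 2 * (p * max_free G U V)"
proof -
  let ?F = "firsts R" and ?L = "lasts R"
  let ?N = "{n. regular G U V p ?F ?L n}"
  have step: "card (closing_components G U V ?F ?L n) + card (closing_components G U V ?L ?F n)
      \<le> max_free G U V" if n: "regular G U V p ?F ?L n" for n
  proof -
    have "K \<noteq> {}" if "K \<in> free_components G U V S" for K S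
      using that by (auto simp: free_components_def)
    then have "closing_components G U V ?F ?L n \<inter> closing_components G U V ?L ?F n = {}"
      using firsts_lasts_disjoint by (fastforce simp: closing_components_def)
    then have "card (closing_components G U V ?F ?L n) + card (closing_components G U V ?L ?F n)
        = card (closing_components G U V ?F ?L n \<union> closing_components G U V ?L ?F n)"
      by (intro card_Un_disjoint[symmetric] finite_closing_components)
    also have "\<dots> \<le> card (free_components G U V (middle G ?F ?L n))"
      by (intro card_mono finite_free_components)
         (auto simp: closing_components_def middle_commute)
    also have "\<dots> \<le> max_free G U V"
      using n by (intro card_free_components_le separator_middle) (auto simp: regular_def)
    finally show ?thesis .
  qed
  have "closings G U V p ?F ?L + closings G U V p ?L ?F \<le> (\<Sum>n\<in>?N. max_free G U V)"
    unfolding closings_def regular_commute[of G U V p ?L] sum.distrib[symmetric]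
    using step by (intro sum_mono) auto
  also have "\<dots> = card ?N * max_free G U V" by simp
  also have "\<dots> \<le> card {..<2 * p} * max_free G U V"
    by (intro mult_right_mono card_mono) (auto simp: regular_def)
  finally show ?thesis by simp
qed

text \<open>Double counting of role-replica pairs: each pair is exactly one of first, last and
  middle.\<close>

lemma (in replica_family) card_firsts_lasts:
  "card (firsts R) + card (lasts R) + (\<Sum>n<2 * p. card (middle G (firsts R) (lasts R) n))
     = card (verts G) * (2 * p)"
proof -
  let ?F = "firsts R" and ?L = "lasts R"
  let ?M = "(\<lambda>(n, x). (x, n)) ` (SIGMA n:{..<2 * p}. middle G ?F ?L n)"
  have fin: "finite (middle G ?F ?L n)" for n by (simp add: middle_def)
  have "verts G \<times> {..<2 * p} = (?F \<union> ?L) \<union> ?M"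
    using firsts_subset lasts_subset by (auto simp: middle_def image_iff)
  moreover have "(?F \<union> ?L) \<inter> ?M = {}" by (auto simp: middle_def)
  moreover have finFL: "finite ?F" "finite ?L"
    using firsts_subset lasts_subset by (auto intro: finite_subset)
  moreover have "finite ?M" using fin by auto
  ultimately have "card (verts G \<times> {..<2 * p}) = card (?F \<union> ?L) + card ?M"
    by (simp add: card_Un_disjoint)
  moreover have "card (?F \<union> ?L) = card ?F + card ?L"
    using finFL firsts_lasts_disjoint by (rule card_Un_disjoint)
  moreover have "card ?M = (\<Sum>n<2 * p. card (middle G ?F ?L n))"
    using fin by (subst card_image) (auto simp: inj_on_def)
  ultimately show ?thesis by (simp add: card_cartesian_product)
qed

text \<open>
  Every interior replica contributes a separator, so each irregular interior replica costs at
  least one half of a unit of defect.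
\<close>

lemma (in replica_family) card_irregular_le:
  assumes "0 < p"
    and defect: "int (card (firsts R) + card (lasts R)) =
      2 * (int p * (int (card (verts G)) - int (min_sep_size G U V)) + int (min_sep_size G U V) - int \<delta>)"
  shows "card {n. n < 2 * p \<and> \<not> regular G U V p (firsts R) (lasts R) n} \<le> 2 + 2 * \<delta>"
proof -
  let ?m = "\<lambda>n. card (middle G (firsts R) (lasts R) n)" and ?s = "min_sep_size G U V"
  let ?I = "{1..<2 * p - 1}"
  have min: "?s \<le> ?m n" if "n \<in> ?I" for n
    using that by (intro min_sep_size_le finite_verts separator_middle) auto
  have "card ?I * ?s + card {n \<in> ?I. ?m n \<noteq> ?s} = (\<Sum>n\<in>?I. ?s + of_bool (?m n \<noteq> ?s))"
    by (simp add: sum.distrib Int_def)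
  also have "\<dots> \<le> (\<Sum>n\<in>?I. ?m n)"
  proof (rule sum_mono)
    show "?s + of_bool (?m n \<noteq> ?s) \<le> ?m n" if "n \<in> ?I" for n
      using min[OF that] by (cases "?m n = ?s") simp_all
  qed
  also have "\<dots> \<le> (\<Sum>n<2 * p. ?m n)" by (intro sum_mono2) auto
  finally have low: "card ?I * ?s + card {n \<in> ?I. ?m n \<noteq> ?s} \<le> (\<Sum>n<2 * p. ?m n)" .
  have "int (card ?I) = 2 * int p - 2" using \<open>0 < p\<close> by simp
  then have "int (card ?I * ?s) = 2 * (int p * int ?s) - 2 * int ?s"
    unfolding of_nat_mult by (simp add: algebra_simps)
  moreover have "int (card (firsts R)) + int (card (lasts R)) + int (\<Sum>n<2 * p. ?m n)
      = 2 * (int p * int (card (verts G)))"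
    using card_firsts_lasts by (simp only: flip: of_nat_add) simp
  moreover have "int (card ?I * ?s) + int (card {n \<in> ?I. ?m n \<noteq> ?s}) \<le> int (\<Sum>n<2 * p. ?m n)"
    using low by (simp only: of_nat_le_iff flip: of_nat_add)
  moreover have "int (card (firsts R)) + int (card (lasts R))
      = 2 * (int p * int (card (verts G))) - 2 * (int p * int ?s) + 2 * int ?s - 2 * int \<delta>"
    using defect by (simp add: algebra_simps)
  \<comment> \<open>The defect equation makes the total middle count
    \<open>(2 * p - 2) * ?s + 2 * \<delta>\<close>; the \<open>2 * p - 2\<close> interior replicas
    already use \<open>?s\<close> each, and every irregular one uses at least one more.\<close>
  ultimately have "int (card {n \<in> ?I. ?m n \<noteq> ?s}) \<le> 2 * int \<delta>" by linarith
  then have irr: "card {n \<in> ?I. ?m n \<noteq> ?s} \<le> 2 * \<delta>" by simp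
  have "{n. n < 2 * p \<and> \<not> regular G U V p (firsts R) (lasts R) n} \<subseteq> {0, 2 * p - 1} \<union> {n \<in> ?I. ?m n \<noteq> ?s}"
    by (auto simp: regular_def)
  then have "card {n. n < 2 * p \<and> \<not> regular G U V p (firsts R) (lasts R) n}
      \<le> card ({0, 2 * p - 1} \<union> {n \<in> ?I. ?m n \<noteq> ?s})"
    by (intro card_mono) auto
  also have "\<dots> \<le> card {0, 2 * p - 1} + card {n \<in> ?I. ?m n \<noteq> ?s}" by (rule card_Un_le)
  also have "card {0, 2 * p - 1} \<le> 2" by (simp add: card_insert_if)
  finally show ?thesis using irr by simp
qed

section \<open>Reversal of the replica order\<close>

text \<open>The range conditions matter because truncated subtraction would send every
  \<open>i\<close> beyond the range to replica 0.\<close>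

definition mirror :: "nat \<Rightarrow> ('a \<Rightarrow> nat \<Rightarrow> nat \<Rightarrow> bool) \<Rightarrow> 'a \<Rightarrow> nat \<Rightarrow> nat \<Rightarrow> bool" where
  "mirror p R x i j \<longleftrightarrow> i < 2 * p \<and> j < 2 * p \<and> R x (2 * p - 1 - i) (2 * p - 1 - j)"

definition flip :: "nat \<Rightarrow> ('a \<times> nat) set \<Rightarrow> ('a \<times> nat) set" where
  "flip p F = {(x, n). n < 2 * p \<and> (x, 2 * p - 1 - n) \<in> F}"

lemma card_flip:
  assumes "F \<subseteq> A \<times> {..<2 * p}"
  shows "card (flip p F) = card F"
  by (rule bij_betw_same_card[of "\<lambda>(x, n). (x, 2 * p - 1 - n)"],
      rule bij_betw_byWitness[where f' = "\<lambda>(x, n). (x, 2 * p - 1 - n)"])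
     (use assms in \<open>auto simp: flip_def\<close>)

lemma middle_flip: "n < 2 * p \<Longrightarrow> middle G (flip p F) (flip p L) n = middle G F L (2 * p - 1 - n)"
  by (auto simp: middle_def flip_def)

lemma regular_flip:
  "n < 2 * p \<Longrightarrow> regular G U V p (flip p F) (flip p L) n \<longleftrightarrow> regular G U V p F L (2 * p - 1 - n)"
  by (auto simp: regular_def middle_flip)

lemma closing_components_flip:
  "n < 2 * p \<Longrightarrow>
     closing_components G U V (flip p F) (flip p L) n = closing_components G U V F L (2 * p - 1 - n)"
  by (auto simp: closing_components_def middle_flip) (auto simp: flip_def)

lemma closings_flip: "closings G U V p (flip p F) (flip p L) = closings G U V p F L"
  unfolding closings_def
proof (rule sum.reindex_bij_witness[where i = "\<lambda>n. 2 * p - 1 - n" and j = "\<lambda>n. 2 * p - 1 - n"])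
  have bound: "n < 2 * p" if "regular G U V p F' L' n" for n F' L'
    using that by (simp add: regular_def)
  fix n
  {
    assume "n \<in> {n. regular G U V p (flip p F) (flip p L) n}"
    then have reg: "regular G U V p (flip p F) (flip p L) n" by simp
    then show "2 * p - 1 - (2 * p - 1 - n) = n"
      and "2 * p - 1 - n \<in> {n. regular G U V p F L n}"
      and "card (closing_components G U V F L (2 * p - 1 - n)) =
        card (closing_components G U V (flip p F) (flip p L) n)"
      using bound[OF reg] by (simp_all add: regular_flip closing_components_flip)
  }
  {
    assume "n \<in> {n. regular G U V p F L n}"
    then have reg: "regular G U V p F L n" by simp
    then show "2 * p - 1 - (2 * p - 1 - n) = n"
      and "2 * p - 1 - n \<in> {n. regular G U V p (flip p F) (flip p L) n}"
      using bound[OF reg] by (simp_all add: regular_flip)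
  }
qed

context replica_family
begin

text \<open>Reflection reverses the order, so the least element of a block becomes the
  greatest.\<close>

lemma firsts_mirror: "firsts (mirror p R) = flip p (lasts R)"
proof -
  have "(x, n) \<in> firsts (mirror p R) \<longleftrightarrow> (x, n) \<in> flip p (lasts R)" for x n
  proof (cases "n < 2 * p \<and> R x (2 * p - 1 - n) (2 * p - 1 - n)")
    case True
    have "(\<forall>j<2 * p. R x (2 * p - 1 - n) (2 * p - 1 - j) \<longrightarrow> n \<le> j)
        \<longleftrightarrow> (\<forall>j. R x (2 * p - 1 - n) j \<longrightarrow> j \<le> 2 * p - 1 - n)" (is "?A \<longleftrightarrow> ?B")
    proof
      assume A: ?A
      show ?B
      proof (intro allI impI)
        fix j assume j: "R x (2 * p - 1 - n) j"
        then have "j < 2 * p" using rel_dom by blast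
        then have "2 * p - 1 - (2 * p - 1 - j) = j" by simp
        then show "j \<le> 2 * p - 1 - n" using A[rule_format, of "2 * p - 1 - j"] j \<open>j < 2 * p\<close> True by simp
      qed
    next
      assume B: ?B
      show ?A
      proof (intro allI impI)
        fix j assume "j < 2 * p" "R x (2 * p - 1 - n) (2 * p - 1 - j)"
        then have "2 * p - 1 - j \<le> 2 * p - 1 - n" using B by blast
        then show "n \<le> j" using \<open>j < 2 * p\<close> True by linarith
      qed
    qed
    then show ?thesis using True by (auto simp: firsts_def lasts_def flip_def mirror_def)
  qed (auto simp: firsts_def lasts_def flip_def mirror_def)
  then show ?thesis by auto
qed

lemma lasts_mirror: "lasts (mirror p R) = flip p (firsts R)"
proof -
  have "(x, n) \<in> lasts (mirror p R) \<longleftrightarrow> (x, n) \<in> flip p (firsts R)" for x n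
  proof (cases "n < 2 * p \<and> R x (2 * p - 1 - n) (2 * p - 1 - n)")
    case True
    have "(\<forall>j<2 * p. R x (2 * p - 1 - n) (2 * p - 1 - j) \<longrightarrow> j \<le> n)
        \<longleftrightarrow> (\<forall>j. R x (2 * p - 1 - n) j \<longrightarrow> 2 * p - 1 - n \<le> j)" (is "?A \<longleftrightarrow> ?B")
    proof
      assume A: ?A
      show ?B
      proof (intro allI impI)
        fix j assume j: "R x (2 * p - 1 - n) j"
        then have "j < 2 * p" using rel_dom by blast
        then have "2 * p - 1 - (2 * p - 1 - j) = j" by simp
        then show "2 * p - 1 - n \<le> j" using A[rule_format, of "2 * p - 1 - j"] j \<open>j < 2 * p\<close> True by simp
      qed
    next
      assume B: ?B
      show ?A
      proof (intro allI impI)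
        fix j assume "j < 2 * p" "R x (2 * p - 1 - n) (2 * p - 1 - j)"
        then have "2 * p - 1 - n \<le> 2 * p - 1 - j" using B by blast
        then show "j \<le> n" using \<open>j < 2 * p\<close> True by linarith
      qed
    qed
    then show ?thesis using True by (auto simp: firsts_def lasts_def flip_def mirror_def)
  qed (auto simp: firsts_def lasts_def flip_def mirror_def)
  then show ?thesis by auto
qed

lemma replica_family_mirror: "replica_family G U V p (mirror p R)"
proof
  show "boundary_core G U V" by (rule core)
  show "x \<in> verts G \<and> i < 2 * p \<and> j < 2 * p" if "mirror p R x i j" for x i j
    using that rel_dom by (auto simp: mirror_def)
  show "mirror p R x i i" if "x \<in> verts G" "i < 2 * p" for x i
    using that rel_refl by (simp add: mirror_def)
  show "mirror p R x j i" if "mirror p R x i j" for x i j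
    using that rel_sym by (auto simp: mirror_def)
  show "mirror p R x i k" if "mirror p R x i j" "mirror p R x j k" for x i j k
    using that rel_trans by (auto simp: mirror_def)
  show "\<exists>j. j \<noteq> i \<and> mirror p R x i j" if xi: "x \<in> verts G" "i < 2 * p" for x i
  proof -
    have "2 * p - 1 - i < 2 * p" using xi(2) by linarith
    then obtain j where j: "j \<noteq> 2 * p - 1 - i" "R x (2 * p - 1 - i) j"
      using nontrivial[OF xi(1)] by blast
    then have "j < 2 * p" using rel_dom by blast
    then have "2 * p - 1 - j \<noteq> i" "mirror p R x i (2 * p - 1 - j)"
      using j xi(2) by (auto simp: mirror_def)
    then show ?thesis by blast
  qed
  show "even (card {j. mirror p R x i j \<and> mirror p R y k j})" if "x \<rightarrow>\<^bsub>G\<^esub> y" for x y i k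
  proof (cases "i < 2 * p \<and> k < 2 * p")
    case True
    have "bij_betw (\<lambda>j. 2 * p - 1 - j) {j. mirror p R x i j \<and> mirror p R y k j}
        {j. R x (2 * p - 1 - i) j \<and> R y (2 * p - 1 - k) j}"
    proof (rule bij_betw_byWitness[where f' = "\<lambda>j. 2 * p - 1 - j"])
      have "j < 2 * p" if "R x (2 * p - 1 - i) j" for j using that rel_dom by blast
      then show "(\<lambda>j. 2 * p - 1 - j) ` {j. R x (2 * p - 1 - i) j \<and> R y (2 * p - 1 - k) j}
          \<subseteq> {j. mirror p R x i j \<and> mirror p R y k j}"
        and "\<forall>j\<in>{j. R x (2 * p - 1 - i) j \<and> R y (2 * p - 1 - k) j}. 2 * p - 1 - (2 * p - 1 - j) = j"
        using True by (fastforce simp: mirror_def)+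
    qed (auto simp: mirror_def)
    then show ?thesis using parity[OF that] by (simp add: bij_betw_same_card)
  qed (auto simp: mirror_def)
  show "mirror p R x n (Suc n)" if "Suc n < 2 * p" "x \<in> set (if even n then V else U)" for x n
  proof -
    \<comment> \<open>The pair \<open>{n, n + 1}\<close> is reflected to \<open>{m, m + 1}\<close>
      with \<open>m\<close> of the same parity as \<open>n\<close>, so \<open>U\<close> and
      \<open>V\<close> keep their roles.\<close>
    define m where "m = 2 * p - 2 - n"
    have m: "2 * p - 1 - n = Suc m" "2 * p - 1 - Suc n = m"
      using that(1) by (auto simp: m_def)
    have "Suc m < 2 * p" using that(1) by (simp add: m_def)
    moreover have "even m \<longleftrightarrow> even n" using that(1) by (auto simp: m_def)
    ultimately have "R x m (Suc m)" using boundary[of m x] that(2) by simp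
    then show ?thesis using m that(1) rel_sym by (simp add: mirror_def)
  qed
qed

lemma mirror_mirror: "mirror p (mirror p R) = R"
proof -
  have "mirror p (mirror p R) x i j \<longleftrightarrow> R x i j" for x i j
    using rel_dom[of x i j] by (auto simp: mirror_def)
  then show ?thesis by blast
qed

end

section \<open>Legal states as replica families\<close>

text \<open>The vertex condition makes the relation empty where a state takes the value
  \<open>undefined\<close>.\<close>

definition block_rel ::
    "('a, 'b) pre_digraph \<Rightarrow> ('a \<Rightarrow> nat set set) \<Rightarrow> 'a \<Rightarrow> nat \<Rightarrow> nat \<Rightarrow> bool" where
  "block_rel G \<pi> x i j \<longleftrightarrow> x \<in> verts G \<and> (\<exists>B \<in> \<pi> x. i \<in> B \<and> j \<in> B)"

lemma block_relI: "x \<in> verts G \<Longrightarrow> B \<in> \<pi> x \<Longrightarrow> i \<in> B \<Longrightarrow> j \<in> B \<Longrightarrow> block_rel G \<pi> x i j"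
  by (auto simp: block_rel_def)

lemma legal_state_partition:
  assumes "\<pi> \<in> legal_states G U V p" "x \<in> verts G"
  shows "partition_on {..<2 * p} (\<pi> x)" and "B \<in> \<pi> x \<Longrightarrow> even (card B)"
  using assms by (auto simp: legal_states_def even_partition_def PiE_iff)

lemma block_rel_block:
  assumes "\<pi> \<in> legal_states G U V p" "x \<in> verts G" "B \<in> \<pi> x" "i \<in> B"
  shows "block_rel G \<pi> x i j \<longleftrightarrow> j \<in> B"
proof -
  have "C = B" if "C \<in> \<pi> x" "i \<in> C" for C
    using partition_onD2[OF legal_state_partition(1)[OF assms(1,2)]] that assms(3,4)
    by (auto dest: disjointD)
  then show ?thesis unfolding block_rel_def using assms(2-4) by blast
qed

lemma legal_state_block:
  assumes "\<pi> \<in> legal_states G U V p" "x \<in> verts G" "i < 2 * p"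
  obtains B where "B \<in> \<pi> x" "i \<in> B"
  using partition_onD1[OF legal_state_partition(1)[OF assms(1,2)]] assms(3) by auto

lemma block_rel_bounded:
  assumes "\<pi> \<in> legal_states G U V p" "block_rel G \<pi> x i j"
  shows "x \<in> verts G" "i < 2 * p" "j < 2 * p"
proof -
  show x: "x \<in> verts G" using assms(2) by (simp add: block_rel_def)
  have "\<Union> (\<pi> x) = {..<2 * p}"
    using partition_onD1[OF legal_state_partition(1)[OF assms(1) x]] by simp
  then show "i < 2 * p" "j < 2 * p" using assms(2) by (auto simp: block_rel_def)
qed

lemma replica_family_block_rel:
  assumes core: "boundary_core G U V" and legal: "\<pi> \<in> legal_states G U V p"
  shows "replica_family G U V p (block_rel G \<pi>)"
proof -
  interpret graph G using core by (simp add: boundary_core_def)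
  note block = block_rel_block[OF legal] and ex_block = legal_state_block[OF legal]
  show ?thesis
  proof
    show "boundary_core G U V" by (rule core)
    show "x \<in> verts G \<and> i < 2 * p \<and> j < 2 * p" if "block_rel G \<pi> x i j" for x i j
      using block_rel_bounded[OF legal that] by simp
    show "block_rel G \<pi> x i i" if "x \<in> verts G" "i < 2 * p" for x i
      using ex_block[OF that] block_relI[OF that(1)] by metis
    show "block_rel G \<pi> x j i" if "block_rel G \<pi> x i j" for x i j
      using that by (auto simp: block_rel_def)
    show "block_rel G \<pi> x i k" if ij: "block_rel G \<pi> x i j" and jk: "block_rel G \<pi> x j k" for x i j k
    proof -
      obtain B where "x \<in> verts G" "B \<in> \<pi> x" "i \<in> B" "j \<in> B"
        using ij by (auto simp: block_rel_def)
      then show ?thesis using block[of x B j k] jk block[of x B i k] by blast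
    qed
    show "\<exists>j. j \<noteq> i \<and> block_rel G \<pi> x i j" if x: "x \<in> verts G" "i < 2 * p" for x i
    proof -
      obtain B where B: "B \<in> \<pi> x" "i \<in> B" using ex_block[OF x] by blast
      then have "B \<noteq> {i}" using legal_state_partition(2)[OF legal x(1) B(1)] by auto
      then obtain j where "j \<in> B" "j \<noteq> i" using B(2) by blast
      then show ?thesis using block_relI[of x G B \<pi> i j] x(1) B by blast
    qed
    show "even (card {j. block_rel G \<pi> x i j \<and> block_rel G \<pi> y k j})" if "x \<rightarrow>\<^bsub>G\<^esub> y" for x y i k
    proof (cases "i < 2 * p \<and> k < 2 * p")
      case True
      have xy: "x \<in> verts G" "y \<in> verts G" using that adj_in_verts by blast+
      obtain B C where B: "B \<in> \<pi> x" "i \<in> B" and C: "C \<in> \<pi> y" "k \<in> C"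
        using ex_block xy True by metis
      \<comment> \<open>The set in the parity condition is an intersection of two blocks: empty, or
        a block of the common refinement and hence even.\<close>
      have eq: "{j. block_rel G \<pi> x i j \<and> block_rel G \<pi> y k j} = B \<inter> C"
        using block[OF xy(1) B] block[OF xy(2) C] by auto
      show ?thesis
      proof (cases "B \<inter> C = {}")
        case False
        \<comment> \<open>If the two partitions coincide, the refined family is a singleton and a
          choice function has only one value, so \<open>B\<close> and \<open>C\<close> must
          agree.\<close>
        have same: "B = C" if "\<pi> x = \<pi> y"
          using partition_onD2[OF legal_state_partition(1)[OF legal xy(1)]] B(1) C(1) that False
          by (auto dest: disjointD)
        define f where "f P = (if P = \<pi> x then B else C)" for P
        have "f \<in> (\<Pi> P\<in>{\<pi> x, \<pi> y}. P)" "\<Inter> (f ` {\<pi> x, \<pi> y}) = B \<inter> C"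
          using B C same by (auto simp: f_def)
        then have "B \<inter> C \<in> common_refinement {\<pi> x, \<pi> y}"
          unfolding common_refinement using False by blast
        moreover have "even_partition p (common_refinement {\<pi> x, \<pi> y})"
          using legal that by (simp add: legal_states_def)
        ultimately show ?thesis unfolding eq by (simp add: even_partition_def)
      qed (simp add: eq)
    next
      case False
      then have "{j. block_rel G \<pi> x i j \<and> block_rel G \<pi> y k j} = {}"
        using block_rel_bounded[OF legal] by blast
      then show ?thesis by (simp only: card.empty even_zero)
    qed
    show "block_rel G \<pi> x n (Suc n)" if n: "Suc n < 2 * p" and x: "x \<in> set (if even n then V else U)" for x n
    proof -
      have "x \<in> verts G" using x core by (auto simp: boundary_core_def split: if_splits)
      have "\<exists>B \<in> \<pi> x. {n, Suc n} \<subseteq> B"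
      proof (cases "even n")
        case True
        then have "{n, Suc n} \<in> eta p" using n by (auto simp: eta_def elim!: evenE)
        moreover have "refines {..<2 * p} (eta p) (\<pi> x)"
          using legal x True by (simp add: legal_states_def)
        ultimately show ?thesis unfolding refines_def by blast
      next
        case False
        then have "{n, Suc n} \<in> tau p" using n by (auto simp: tau_def elim!: oddE)
        moreover have "refines {..<2 * p} (tau p) (\<pi> x)"
          using legal x False by (simp add: legal_states_def)
        ultimately show ?thesis unfolding refines_def by blast
      qed
      then show ?thesis using \<open>x \<in> verts G\<close> by (auto simp: block_rel_def)
    qed
  qed
qed

text \<open>The blocks are recovered as the classes of the relation, and outside the graph
  extensionality fixes the state.\<close>

lemma inj_on_block_rel: "inj_on (block_rel G) (legal_states G U V p)"
proof (rule inj_onI)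
  fix \<pi> \<psi> assume legal: "\<pi> \<in> legal_states G U V p" "\<psi> \<in> legal_states G U V p"
    and eq: "block_rel G \<pi> = block_rel G \<psi>"
  have blocks: "\<phi> x = (\<lambda>i. {j. block_rel G \<phi> x i j}) ` {..<2 * p}"
    if \<phi>: "\<phi> \<in> legal_states G U V p" and x: "x \<in> verts G" for \<phi> x
  proof -
    have B: "{j. block_rel G \<phi> x i j} = B" if "B \<in> \<phi> x" "i \<in> B" for B i
      using block_rel_block[OF \<phi> x that] by auto
    note P = legal_state_partition(1)[OF \<phi> x]
    show ?thesis
    proof (intro equalityI subsetI)
      fix B assume "B \<in> \<phi> x"
      moreover obtain i where "i \<in> B" using partition_onD3[OF P] \<open>B \<in> \<phi> x\<close> by (metis equals0I)
      moreover have "i < 2 * p" using partition_onD1[OF P] calculation by blast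
      ultimately show "B \<in> (\<lambda>i. {j. block_rel G \<phi> x i j}) ` {..<2 * p}"
        using B by (auto intro!: image_eqI[of _ _ i])
    next
      fix B assume "B \<in> (\<lambda>i. {j. block_rel G \<phi> x i j}) ` {..<2 * p}"
      then obtain i where i: "i < 2 * p" "B = {j. block_rel G \<phi> x i j}" by auto
      obtain C where "C \<in> \<phi> x" "i \<in> C" using legal_state_block[OF \<phi> x i(1)] .
      then show "B \<in> \<phi> x" using B i(2) by simp
    qed
  qed
  have "\<pi> x = \<psi> x" if "x \<in> verts G" for x
    using blocks[OF legal(1) that] blocks[OF legal(2) that] eq by simp
  moreover have "\<pi> x = undefined" "\<psi> x = undefined" if "x \<notin> verts G" for x
    using legal that by (auto simp: legal_states_def PiE_iff extensional_def)
  ultimately show "\<pi> = \<psi>" by (metis ext)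
qed

text \<open>\<open>Min\<close> and \<open>Max\<close> map the blocks bijectively onto the first and
  the last replicas. This turns the defect into a count of first and last pairs.\<close>

lemma
  assumes legal: "\<pi> \<in> legal_states G U V p" and x: "x \<in> verts G"
  shows card_firsts_block_rel: "card {n. (x, n) \<in> firsts (block_rel G \<pi>)} = card (\<pi> x)"
    and card_lasts_block_rel: "card {n. (x, n) \<in> lasts (block_rel G \<pi>)} = card (\<pi> x)"
proof -
  note P = legal_state_partition(1)[OF legal x]
  have fin: "finite B" "B \<noteq> {}" if "B \<in> \<pi> x" for B
    using that partition_onD1[OF P] partition_onD3[OF P] by (auto intro: finite_subset[of B "{..<2 * p}"])
  have same: "B = C" if "B \<in> \<pi> x" "C \<in> \<pi> x" "n \<in> B" "n \<in> C" for B C n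
    using partition_onD2[OF P] that by (auto dest: disjointD)
  note rel = block_rel_block[OF legal x]
  have "{n. (x, n) \<in> firsts (block_rel G \<pi>)} = Min ` \<pi> x"
  proof (intro equalityI subsetI)
    fix n assume "n \<in> {n. (x, n) \<in> firsts (block_rel G \<pi>)}"
    then have n: "block_rel G \<pi> x n n" "\<And>j. block_rel G \<pi> x n j \<Longrightarrow> n \<le> j" by (auto simp: firsts_def)
    then obtain B where B: "B \<in> \<pi> x" "n \<in> B" by (auto simp: block_rel_def)
    then have "Min B = n" using n(2) rel[OF B] fin by (intro Min_eqI) auto
    then show "n \<in> Min ` \<pi> x" using B by blast
  next
    fix n assume "n \<in> Min ` \<pi> x"
    then obtain B where "B \<in> \<pi> x" "n = Min B" by blast
    then show "n \<in> {n. (x, n) \<in> firsts (block_rel G \<pi>)}"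
      using fin[of B] rel[of B n] by (simp add: firsts_def)
  qed
  moreover have "inj_on Min (\<pi> x)" by (rule inj_onI) (metis same fin Min_in)
  ultimately show "card {n. (x, n) \<in> firsts (block_rel G \<pi>)} = card (\<pi> x)"
    by (simp add: card_image)
  have "{n. (x, n) \<in> lasts (block_rel G \<pi>)} = Max ` \<pi> x"
  proof (intro equalityI subsetI)
    fix n assume "n \<in> {n. (x, n) \<in> lasts (block_rel G \<pi>)}"
    then have n: "block_rel G \<pi> x n n" "\<And>j. block_rel G \<pi> x n j \<Longrightarrow> j \<le> n" by (auto simp: lasts_def)
    then obtain B where B: "B \<in> \<pi> x" "n \<in> B" by (auto simp: block_rel_def)
    then have "Max B = n" using n(2) rel[OF B] fin by (intro Max_eqI) auto
    then show "n \<in> Max ` \<pi> x" using B by blast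
  next
    fix n assume "n \<in> Max ` \<pi> x"
    then obtain B where "B \<in> \<pi> x" "n = Max B" by blast
    then show "n \<in> {n. (x, n) \<in> lasts (block_rel G \<pi>)}"
      using fin[of B] rel[of B n] by (simp add: lasts_def)
  qed
  moreover have "inj_on Max (\<pi> x)" by (rule inj_onI) (metis same fin Max_in)
  ultimately show "card {n. (x, n) \<in> lasts (block_rel G \<pi>)} = card (\<pi> x)"
    by (simp add: card_image)
qed

text \<open>Nonempty blocks of even size have at least two elements.\<close>

lemma card_legal_state_le:
  assumes legal: "\<pi> \<in> legal_states G U V p" and x: "x \<in> verts G"
  shows "card (\<pi> x) \<le> p"
proof -
  note P = legal_state_partition(1)[OF legal x]
  have fin: "finite B" if "B \<in> \<pi> x" for B
    using that partition_onD1[OF P] by (auto intro: finite_subset[of B "{..<2 * p}"])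
  have ge2: "2 \<le> card B" if "B \<in> \<pi> x" for B
  proof -
    have "card B \<noteq> 0" using fin[OF that] that partition_onD3[OF P] by auto
    then show ?thesis using legal_state_partition(2)[OF legal x that] by (cases "card B = 1") auto
  qed
  have "2 * card (\<pi> x) = (\<Sum>B\<in>\<pi> x. 2)" by simp
  also have "\<dots> \<le> (\<Sum>B\<in>\<pi> x. card B)" using ge2 by (rule sum_mono)
  also have "\<dots> = card (\<Union> (\<pi> x))"
    using partition_onD2[OF P] fin by (intro card_Union_disjoint[symmetric]) (auto simp: disjoint_def pairwise_def disjnt_def)
  also have "\<dots> = 2 * p" by (simp flip: partition_onD1[OF P])
  finally show ?thesis by simp
qed

section \<open>The bound\<close>

lemma card_eq_sum_slices:
  fixes N :: nat
  assumes "finite A" and "F \<subseteq> A \<times> {..<N}"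
  shows "card F = (\<Sum>x\<in>A. card {n. (x, n) \<in> F})"
proof -
  have "F = (SIGMA x:A. {n. (x, n) \<in> F})" using assms(2) by auto
  then have "card F = card (SIGMA x:A. {n. (x, n) \<in> F})" by (rule arg_cong)
  also have "\<dots> = (\<Sum>x\<in>A. card {n. (x, n) \<in> F})"
  proof (intro card_SigmaI ballI)
    show "finite {n. (x, n) \<in> F}" for x
      by (rule finite_subset[of _ "{..<N}"]) (use assms(2) in auto)
  qed fact
  finally show ?thesis .
qed

lemma (in replica_family) card_hints_le_defect:
  assumes "0 < p"
    and "int (card (firsts R) + card (lasts R)) =
      2 * (int p * (int (card (verts G)) - int (min_sep_size G U V)) + int (min_sep_size G U V) - int \<delta>)"
    and "closings G U V p (firsts R) (lasts R) \<le> c"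
  shows "card (hints G U V p (firsts R) (lasts R)) \<le> card (verts G) * (2 + 2 * \<delta>) + c"
  using card_hints_le[of U V p "firsts R" "lasts R"] assms(3)
    mult_left_mono[OF card_irregular_le[OF assms(1,2)], of "card (verts G)"] by linarith

text \<open>By \<open>closings_sum_le\<close> at least one direction has at most
  \<open>p * max_free G U V\<close> closings. States good from left to right are counted directly
  and the others through their mirror images, whence the factor 2. The term with
  \<open>\<delta>\<close> pays for all roles at the irregular replicas.\<close>

lemma card_states_le:
  assumes core: "boundary_core G U V" and "0 < p"
  shows "state_count G U V p \<delta> \<le>
    2 * (16 ^ (p * card (verts G)) * p ^ (card (verts G) * (2 + 2 * \<delta>) + p * max_free G U V))"
proof -
  interpret graph G using core by (simp add: boundary_core_def)
  define h where "h = card (verts G) * (2 + 2 * \<delta>) + p * max_free G U V"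
  define \<Omega> where "\<Omega> = block_rel G ` {\<pi> \<in> legal_states G U V p. defect G U V p \<pi> = int \<delta>}"
  define \<Omega>1 where "\<Omega>1 = {R \<in> \<Omega>. closings G U V p (firsts R) (lasts R) \<le> p * max_free G U V}"
  define \<Omega>2 where "\<Omega>2 = {R \<in> \<Omega>. closings G U V p (lasts R) (firsts R) \<le> p * max_free G U V}"
  have family: "replica_family G U V p R" if "R \<in> \<Omega>" for R
    using that replica_family_block_rel[OF core] by (auto simp: \<Omega>_def)
  have slices: "card {n. (x, n) \<in> firsts R} \<le> p" "card {n. (x, n) \<in> lasts R} \<le> p"
    if "R \<in> \<Omega>" "x \<in> verts G" for R x
    using that card_legal_state_le by (auto simp: \<Omega>_def card_firsts_block_rel card_lasts_block_rel)
  have total: "int (card (firsts R) + card (lasts R)) =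
      2 * (int p * (int (card (verts G)) - int (min_sep_size G U V)) + int (min_sep_size G U V) - int \<delta>)"
    if R: "R \<in> \<Omega>" for R
  proof -
    interpret R: replica_family G U V p R by (rule family[OF R])
    obtain \<pi> where \<pi>: "\<pi> \<in> legal_states G U V p" "defect G U V p \<pi> = int \<delta>" "R = block_rel G \<pi>"
      using R by (auto simp: \<Omega>_def)
    define m where "m = (\<Sum>x\<in>verts G. card (\<pi> x))"
    have "card (firsts R) = m" "card (lasts R) = m"
      using card_eq_sum_slices[OF finite_verts R.firsts_subset]
        card_eq_sum_slices[OF finite_verts R.lasts_subset] \<pi>(1)
      by (simp_all add: m_def \<pi>(3) card_firsts_block_rel card_lasts_block_rel)
    then show ?thesis using \<pi>(2) unfolding defect_def m_def[symmetric] by simp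
  qed
  \<comment> \<open>Two numbers with sum at most \<open>2 * (p * max_free G U V)\<close> cannot both
    exceed half of it.\<close>
  have "\<Omega> = \<Omega>1 \<union> \<Omega>2"
  proof -
    have "closings G U V p (firsts R) (lasts R) \<le> p * max_free G U V \<or>
        closings G U V p (lasts R) (firsts R) \<le> p * max_free G U V" if "R \<in> \<Omega>" for R
      using replica_family.closings_sum_le[OF family[OF that]] by linarith
    then show ?thesis by (auto simp: \<Omega>1_def \<Omega>2_def)
  qed
  have bound1: "finite \<Omega>1 \<and> card \<Omega>1 \<le> 16 ^ (p * card (verts G)) * p ^ h"
  proof (rule card_replica_families[where U = U and V = V])
    fix R assume "R \<in> \<Omega>1"
    then have R: "R \<in> \<Omega>" "closings G U V p (firsts R) (lasts R) \<le> p * max_free G U V"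
      by (auto simp: \<Omega>1_def)
    show "replica_family G U V p R" using R(1) by (rule family)
    show "card {n. (x, n) \<in> firsts R} \<le> p" if "x \<in> verts G" for x using R(1) that by (rule slices)
    show "card (hints G U V p (firsts R) (lasts R)) \<le> h"
      unfolding h_def
      using family[OF R(1)] \<open>0 < p\<close> total[OF R(1)] R(2) by (rule replica_family.card_hints_le_defect)
  qed (rule \<open>0 < p\<close>)
  have bound2: "finite (mirror p ` \<Omega>2) \<and> card (mirror p ` \<Omega>2) \<le> 16 ^ (p * card (verts G)) * p ^ h"
  proof (rule card_replica_families[where U = U and V = V])
    fix M assume "M \<in> mirror p ` \<Omega>2"
    then obtain R where M: "M = mirror p R" and R: "R \<in> \<Omega>"
      and c: "closings G U V p (lasts R) (firsts R) \<le> p * max_free G U V"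
      by (auto simp: \<Omega>2_def)
    interpret R: replica_family G U V p R using R by (rule family)
    show M_family: "replica_family G U V p M" unfolding M by (rule R.replica_family_mirror)
    show "card {n. (x, n) \<in> firsts M} \<le> p" if "x \<in> verts G" for x
    proof -
      have "{n. (x, n) \<in> firsts M} \<subseteq> (\<lambda>n. 2 * p - 1 - n) ` {n. (x, n) \<in> lasts R}"
      proof
        fix n assume "n \<in> {n. (x, n) \<in> firsts M}"
        then have "n < 2 * p" "(x, 2 * p - 1 - n) \<in> lasts R"
          unfolding M R.firsts_mirror by (simp_all add: flip_def)
        then show "n \<in> (\<lambda>n. 2 * p - 1 - n) ` {n. (x, n) \<in> lasts R}"
          by (intro image_eqI[of _ _ "2 * p - 1 - n"]) simp_all
      qed
      moreover have fin: "finite {n. (x, n) \<in> lasts R}"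
        by (rule finite_subset[of _ "{..<2 * p}"]) (use R.lasts_subset in auto)
      ultimately have "card {n. (x, n) \<in> firsts M} \<le> card {n. (x, n) \<in> lasts R}"
        by (rule surj_card_le[rotated])
      then show ?thesis using slices(2)[OF R that] by simp
    qed
    have "int (card (firsts M) + card (lasts M)) =
        2 * (int p * (int (card (verts G)) - int (min_sep_size G U V)) + int (min_sep_size G U V) - int \<delta>)"
      unfolding M R.firsts_mirror R.lasts_mirror
        card_flip[OF R.lasts_subset] card_flip[OF R.firsts_subset]
      using total[OF R] by (simp only: add.commute)
    moreover have "closings G U V p (firsts M) (lasts M) \<le> p * max_free G U V"
      using c by (simp only: M R.firsts_mirror R.lasts_mirror closings_flip)
    ultimately show "card (hints G U V p (firsts M) (lasts M)) \<le> h"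
      unfolding h_def by (rule replica_family.card_hints_le_defect[OF M_family \<open>0 < p\<close>])
  qed (rule \<open>0 < p\<close>)
  have "inj_on (mirror p) \<Omega>2"
  proof (rule inj_on_inverseI)
    show "mirror p (mirror p R) = R" if "R \<in> \<Omega>2" for R
      using family[of R] that by (intro replica_family.mirror_mirror) (auto simp: \<Omega>2_def)
  qed
  then have "card \<Omega>2 \<le> 16 ^ (p * card (verts G)) * p ^ h"
    using bound2 by (simp add: card_image)
  moreover have "state_count G U V p \<delta> = card \<Omega>"
    unfolding state_count_def \<Omega>_def
    by (rule card_image[symmetric], rule inj_on_subset[OF inj_on_block_rel[of G U V p]]) auto
  moreover have "card \<Omega> \<le> card \<Omega>1 + card \<Omega>2"
    unfolding \<open>\<Omega> = \<Omega>1 \<union> \<Omega>2\<close> by (rule card_Un_le)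
  ultimately show ?thesis using bound1 unfolding h_def by linarith
qed

text \<open>From \<open>p < 2 ^ p\<close> the factor \<open>p ^ (2 * r)\<close> is at most
  \<open>4 ^ (p * r)\<close>, and the leading 2 is at most \<open>2 ^ (p * r)\<close>. The bases
  multiply to \<open>2 * 16 * 4 = 128\<close>, below \<open>200 ^ 2 = 40000\<close>.\<close>

lemma const_bound:
  fixes p r a \<delta> :: nat
  assumes "0 < r" "0 < p"
  shows "2 * (16 ^ (p * r) * p ^ (r * (2 + 2 * \<delta>) + p * a))
    \<le> C_const r ^ (2 * p) * p ^ (a * p + K_const r * \<delta>)"
proof -
  have "p ^ (r * (2 + 2 * \<delta>) + p * a) = p ^ (2 * r) * p ^ (a * p + 2 * r * \<delta>)"
    by (simp add: algebra_simps flip: power_add)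
  also have "\<dots> \<le> (2 ^ p) ^ (2 * r) * p ^ (a * p + K_const r * \<delta>)"
  proof (rule mult_mono)
    show "p ^ (2 * r) \<le> (2 ^ p) ^ (2 * r)"
      by (intro power_mono less_imp_le[OF less_exp]) simp
    have "2 * r \<le> K_const r" using assms(1) by (simp add: K_const_def)
    then show "p ^ (a * p + 2 * r * \<delta>) \<le> p ^ (a * p + K_const r * \<delta>)"
      using assms(2) by (intro power_increasing add_left_mono mult_right_mono) auto
  qed simp_all
  also have "(2 ^ p) ^ (2 * r) = (4 :: nat) ^ (p * r)"
    by (simp add: power_mult[symmetric] mult.left_commute[of p]) (simp add: power_mult)
  finally have 1: "p ^ (r * (2 + 2 * \<delta>) + p * a) \<le> 4 ^ (p * r) * p ^ (a * p + K_const r * \<delta>)" .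
  have "(2 :: nat) ^ 1 \<le> 2 ^ (p * r)" using assms by (intro power_increasing) auto
  then have "2 * (16 ^ (p * r) * 4 ^ (p * r)) \<le> (2 :: nat) ^ (p * r) * (16 ^ (p * r) * 4 ^ (p * r))"
    by (intro mult_right_mono) simp_all
  also have "\<dots> = 128 ^ (p * r)" by (simp flip: power_mult_distrib)
  also have "\<dots> \<le> 40000 ^ (p * r)" by (rule power_mono) simp_all
  also have "\<dots> = (200 ^ r) ^ (2 * p)"
    by (simp add: power_mult[symmetric] mult.left_commute[of r] mult.commute[of r]) (simp add: power_mult)
  also have "\<dots> \<le> C_const r ^ (2 * p)"
  proof (rule power_mono)
    have "1 * 1 \<le> (2 * r) ^ (2 * r\<^sup>2) * 4 ^ r\<^sup>2" using assms(1) by (intro mult_mono one_le_power) auto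
    then have "200 ^ r * 1 \<le> 200 ^ r * ((2 * r) ^ (2 * r\<^sup>2) * 4 ^ r\<^sup>2)"
      by (intro mult_left_mono) simp_all
    then show "200 ^ r \<le> C_const r" using assms(1) by (simp add: C_const_def mult.assoc)
  qed simp
  finally have 2: "2 * (16 ^ (p * r) * 4 ^ (p * r)) \<le> C_const r ^ (2 * p)" .
  have "2 * (16 ^ (p * r) * p ^ (r * (2 + 2 * \<delta>) + p * a))
      \<le> 2 * (16 ^ (p * r) * (4 ^ (p * r) * p ^ (a * p + K_const r * \<delta>)))"
    using 1 by (intro mult_left_mono) simp_all
  also have "\<dots> = 2 * (16 ^ (p * r) * 4 ^ (p * r)) * p ^ (a * p + K_const r * \<delta>)"
    by (simp only: mult.assoc)
  also have "\<dots> \<le> C_const r ^ (2 * p) * p ^ (a * p + K_const r * \<delta>)"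
    using 2 by (rule mult_right_mono) simp
  finally show ?thesis .
qed

theorem theorem3p4:
  fixes G :: "('a, 'b) pre_digraph" and U V :: "'a list" and p \<delta> r :: nat
  assumes "boundary_core G U V"
    and "card (verts G) = r"
    and "p \<ge> 2"
  shows "state_count G U V p \<delta>
           \<le> C_const r ^ (2 * p) * p ^ (max_free G U V * p + K_const r * \<delta>)"
proof (cases "r = 0")
  case True
  interpret graph G using assms(1) by (simp add: boundary_core_def)
  have "verts G = {}" using True assms(2) by simp
  \<comment> \<open>Without roles the only extensional function is the constant
    \<open>undefined\<close>, so there is at most one state.\<close>
  then have "{\<pi> \<in> legal_states G U V p. defect G U V p \<pi> = int \<delta>} \<subseteq> {\<lambda>x. undefined}"
    by (auto simp: legal_states_def)
  then have "state_count G U V p \<delta> \<le> card {\<lambda>x :: 'a. undefined :: nat set set}"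
    unfolding state_count_def by (intro card_mono) auto
  also have "\<dots> \<le> p ^ (max_free G U V * p)" using assms(3) by simp
  finally show ?thesis using True by (simp add: C_const_def K_const_def)
next
  case False
  have "0 < p" using assms(3) by simp
  have "state_count G U V p \<delta> \<le> 2 * (16 ^ (p * r) * p ^ (r * (2 + 2 * \<delta>) + p * max_free G U V))"
    using card_states_le[OF assms(1) \<open>0 < p\<close>] assms(2) by simp
  also have "\<dots> \<le> C_const r ^ (2 * p) * p ^ (max_free G U V * p + K_const r * \<delta>)"
    using False \<open>0 < p\<close> by (intro const_bound) simp_all
  finally show ?thesis .
qed

end
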